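(* Let $A=(A,m,P)$ be a Nijenhuis associative algebra. Twist the $L_\infty$-algebra $\mathfrak{C}_{\mathrm{NjA}}(A)$ by the Maurer-Cartan element corresponding to the Nijenhuis associative algebra structure. Then its underlying complex is isomorphic to $s\mathrm{C}^\bullet_{\mathrm{NjA}}(A)$, the shift of the cochain complex of the Nijenhuis associative algebra $A$.
   Context: $\mathbf{k}$ is a field of characteristic $0$; gradings are homological; $sV$ is the suspension, $(sV)_n=V_{n-1}$, and $s:V\to sV$ has degree $1$, $s^{-1}$ degree $-1$; Koszul signs are used throughout. A cochain complex $C^\bullet$ is viewed as homologically graded with $C^n$ in degree $-n$, so in $sC^\bullet$ the space $C^n$ sits in degree $1-n$. A Nijenhuis associative algebra $(A,m,P)$ is an associative algebra $(A,m)$ (product written $ab$) with a linear map $P:A\to A$ such that $P(a)P(b)=P(P(a)b+aP(b)-P(ab))$. Here $A$ is considered as a graded space concentrated in degree $0$. The $L_\infty$-algebra. Brace operations: for homogeneous $f:(sV)^{\otimes m}\to sV$ and $g_i:(sV)^{\otimes n_i}\to sV$, $f\{g_1,\dots,g_k\}=\sum f\circ(\mathrm{id}^{\otimes a_0}\otimes g_1\otimes\mathrm{id}^{\otimes a_1}\otimes\cdots\otimes g_k\otimes\mathrm{id}^{\otimes a_k})$ over $a_0+\cdots+a_k+k=m$ (zero if $k>m$; $f\{\}=f$); $[f,g]_{\mathrm G}=f\{g\}-(-1)^{|f||g|}g\{f\}$. With $\overline{T^c}(sV)=\bigoplus_{n\geq 1}(sV)^{\otimes n}$, put $\mathfrak{C}_{\mathrm{Alg}}(V)=\mathrm{Hom}(\overline{T^c}(sV),sV)$,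 $\mathfrak{C}_{\mathrm{NjO}}(V)=\mathrm{Hom}(\overline{T^c}(sV),V)$, $\mathfrak{C}_{\mathrm{NjA}}(V)=\mathfrak{C}_{\mathrm{Alg}}(V)\oplus\mathfrak{C}_{\mathrm{NjO}}(V)$. Elements of $\mathfrak{C}_{\mathrm{Alg}}(V)$ are written $sh$, $|sh|=|h|+1$. Operations: (i) $l_2(sf\otimes sh)=[sf,sh]_{\mathrm G}$ on $\mathfrak{C}_{\mathrm{Alg}}(V)$. (ii) for $n\geq 1$, $sh\in\mathrm{Hom}((sV)^{\otimes n},sV)$, $g_1,\dots,g_n\in\mathfrak{C}_{\mathrm{NjO}}(V)$, $$l_{n+1}(sh\otimes g_1\otimes\cdots\otimes g_n)=\sum_{\sigma\in\mathbb{S}_n}(-1)^{\eta}\Big(\sum_{k=0}^{n}(-1)^{\xi}s^{-1}\circ(sg_{\sigma(1)})\{\cdots\{sg_{\sigma(k)}\{sh\{sg_{\sigma(k+1)},\dots,sg_{\sigma(n)}\}\}\}\cdots\}\Big),$$ with $(-1)^\eta=\chi(\sigma;g_1,\dots,g_n)(-1)^{n(|h|+1)+\sum_{k=1}^{n-1}\sum_{j=1}^{k}|g_{\sigma(j)}|}$ ($\chi$ = sign of $\sigma$ times Koszul sign) and $(-1)^\xi=(-1)^{(|h|+1)\sum_{i=1}^{k}(|g_{\sigma(i)}|+1)+k}$. (iii) $l_{n+1}(g_1\otimes\cdots\otimes g_k\otimes sh\otimes g_{k+1}\otimes\cdots\otimes g_n)=(-1)^{(|h|+1)(\sum_{j=1}^{k}|g_j|)+k}l_{n+1}(sh\otimes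 g_1\otimes\cdots\otimes g_n)$ for $1\le k\le n$. (iv) All other components vanish. Maurer-Cartan elements are degree $-1$ elements $\alpha$ with $\sum_{n\geq 1}\frac{1}{n!}(-1)^{n(n-1)/2}l_n(\alpha^{\otimes n})=0$; twisting by $\alpha$ gives an $L_\infty$-algebra $\{l_n^\alpha\}_{n\geq 1}$ on the same graded space, whose underlying complex has differential $l_1^\alpha(x)=\sum_{i\geq 0}\frac{1}{i!}(-1)^{i(i+1)/2}l_{i+1}(\alpha^{\otimes i}\otimes x)$. The Maurer-Cartan element of $\mathfrak{C}_{\mathrm{NjA}}(A)$ corresponding to the Nijenhuis associative algebra structure $(m,P)$ is $\alpha=(\nu,\tau)$ with $\nu=-s\circ m\circ(s^{-1})^{\otimes 2}:(sA)^{\otimes 2}\to sA$ and $\tau=P\circ s^{-1}:sA\to A$. The cochain complex $\mathrm{C}^\bullet_{\mathrm{NjA}}(A)$. Put $\mathrm{C}^n_{\mathrm{Alg}}(A)=\mathrm{C}^n_{\mathrm{NjO}}(A)=\mathrm{Hom}(A^{\otimes n},A)$, $n\geq 0$. $\delta_{\mathrm{Alg}}^n$ is the Hochschild differential $$\delta^n_{\mathrm{Alg}}(f)(a_1,\dots,a_{n+1})=a_1f(a_2,\dots,a_{n+1})+\sum_{i=1}^{n}(-1)^if(a_1,\dots,a_ia_{i+1},\dots,a_{n+1})+(-1)^{n+1}f(a_1,\dots,a_n)a_{n+1}.$$ Set $a\cdot_Pb=P(a)b+aP(b)-P(ab)$ and $$\partial^n(f)(a_1,\dots,a_{n+1})=P(a_1)f(a_2,\dots,a_{n+1})+\sum_{i=1}^{n}(-1)^if(a_1,\dots,a_i\cdot_Pa_{i+1},\dots,a_{n+1})+(-1)^{n+1}f(a_1,\dots,a_n)P(a_{n+1}),$$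 $\delta^n_{\mathrm{NjO}}(f)=-P\circ\delta^n_{\mathrm{Alg}}(f)+\partial^n(f)$. Let $\Phi^0=\mathrm{Id}$ and, for $n\geq 1$, $\Phi^n(f)=\sum_{S\subseteq\{1,\dots,n\}}(-1)^{n-|S|}P^{n-|S|}\circ f\circ P_S$, where $P_S$ applies $P$ to the tensor factors with index in $S$ and the identity to the others. Then $\mathrm{C}^0_{\mathrm{NjA}}(A)=\mathrm{C}^0_{\mathrm{Alg}}(A)$, $\mathrm{C}^n_{\mathrm{NjA}}(A)=\mathrm{C}^n_{\mathrm{Alg}}(A)\oplus\mathrm{C}^{n-1}_{\mathrm{NjO}}(A)$ for $n\geq 1$, with differential $\delta^n_{\mathrm{NjA}}(f,g)=(\delta^n_{\mathrm{Alg}}(f),-\Phi^n(f)-\delta^{n-1}_{\mathrm{NjO}}(g))$.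
   Formalization: The isomorphism is with the subcomplex of the shifted cochain complex without the arity-0 parts (C^0_Alg in degree 1, C^0_NjO in degree 0), as the L-infinity algebra uses the reduced tensor coalgebra and is 0 in degree 1; as stated the claim fails for A ≠ 0. All degrees below 0 are unchanged. *)

theory Defs
  imports
    Complex_Main
    "HOL-Library.Function_Algebras"
    "HOL-Library.Product_Plus"
    "HOL-Library.Groups_Big_Fun"
    "HOL-Combinatorics.Permutations"
begin

section \<open>Nijenhuis associative algebras\<close>

locale nijenhuis_algebra = vector_space scale
  for scale :: "'k::field_char_0 \<Rightarrow> 'a::ab_group_add \<Rightarrow> 'a" +
  fixes m :: "'a \<Rightarrow> 'a \<Rightarrow> 'a" and P :: "'a \<Rightarrow> 'a"
  assumes linear_left: "Vector_Spaces.linear scale scale (\<lambda>a. m a b)"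
    and linear_right: "Vector_Spaces.linear scale scale (m a)"
    and assoc: "m (m a b) c = m a (m b c)"
    and linear_P: "Vector_Spaces.linear scale scale P"
    and nijenhuis: "m (P a) (P b) = P (m (P a) b + m a (P b) - P (m a b))"


section \<open>Chain complexes (homological grading)\<close>

record 'v graded_complex =
  cmp :: "int \<Rightarrow> 'v set"
  dif :: "int \<Rightarrow> 'v \<Rightarrow> 'v"

definition linear_map_on ::
    "('k::field \<Rightarrow> 'v::ab_group_add \<Rightarrow> 'v) \<Rightarrow> 'v set \<Rightarrow> 'v set \<Rightarrow> ('v \<Rightarrow> 'v) \<Rightarrow> bool" where
  "linear_map_on sc S T f \<longleftrightarrow>
     f ` S \<subseteq> T \<and> (\<forall>x\<in>S. \<forall>y\<in>S. f (x + y) = f x + f y) \<and> (\<forall>c. \<forall>x\<in>S. f (sc c x) = sc c (f x))"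

definition chain_complex ::
    "('k::field \<Rightarrow> 'v::ab_group_add \<Rightarrow> 'v) \<Rightarrow> 'v graded_complex \<Rightarrow> bool" where
  "chain_complex sc K \<longleftrightarrow>
     (\<forall>d. module.subspace sc (cmp K d)) \<and>
     (\<forall>d. linear_map_on sc (cmp K d) (cmp K (d - 1)) (dif K d)) \<and>
     (\<forall>d. \<forall>x\<in>cmp K d. dif K (d - 1) (dif K d x) = 0)"

definition complex_isomorphic ::
    "('k::field \<Rightarrow> 'v::ab_group_add \<Rightarrow> 'v) \<Rightarrow> 'v graded_complex \<Rightarrow> 'v graded_complex \<Rightarrow> bool" where
  "complex_isomorphic sc K L \<longleftrightarrow>
     chain_complex sc K \<and> chain_complex sc L \<and>
     (\<exists>\<phi>. (\<forall>d. linear_map_on sc (cmp K d) (cmp L d) (\<phi> d) \<and> bij_betw (\<phi> d) (cmp K d) (cmp L d)) \<and>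
          (\<forall>d. \<forall>x\<in>cmp K d. \<phi> (d - 1) (dif K d x) = dif L d (\<phi> d x)))"

definition subcomplex ::
    "('k::field \<Rightarrow> 'v::ab_group_add \<Rightarrow> 'v) \<Rightarrow> 'v graded_complex \<Rightarrow> 'v graded_complex \<Rightarrow> bool" where
  "subcomplex sc L K \<longleftrightarrow>
     chain_complex sc L \<and> chain_complex sc K \<and>
     (\<forall>d. cmp L d \<subseteq> cmp K d) \<and> (\<forall>d. \<forall>x\<in>cmp L d. dif L d x = dif K d x)"

text \<open>The suspension of a cochain complex: \<open>C\<^sup>n\<close> is placed in homological degree \<open>1 - n\<close>, and
  moving the differential past the suspension symbol contributes the sign in \<open>d (s x) = - s (d x)\<close>.\<close>

definition shift_cochain ::
    "(nat \<Rightarrow> 'v set) \<Rightarrow> (nat \<Rightarrow> 'v \<Rightarrow> 'v) \<Rightarrow> ('v::ab_group_add) graded_complex" where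
  "shift_cochain C \<delta> =
     \<lparr> cmp = (\<lambda>d. if d \<le> 1 then C (nat (1 - d)) else {0}),
       dif = (\<lambda>d x. if d \<le> 1 then - \<delta> (nat (1 - d)) x else 0) \<rparr>"


section \<open>Multilinear maps\<close>

text \<open>\<open>Hom(A\<^sup>\<otimes>\<^sup>n, A)\<close> as \<open>n\<close>-linear functions on lists of length \<open>n\<close>, extended by \<open>0\<close>
  to lists of other lengths.\<close>

definition Mlin :: "('k::field \<Rightarrow> 'a::ab_group_add \<Rightarrow> 'a) \<Rightarrow> nat \<Rightarrow> ('a list \<Rightarrow> 'a) set" where
  "Mlin scale n =
     {f. (\<forall>xs. length xs \<noteq> n \<longrightarrow> f xs = 0) \<and>
         (\<forall>xs i. length xs = n \<longrightarrow> i < n \<longrightarrow>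
            Vector_Spaces.linear scale scale (\<lambda>x. f (xs[i := x])))}"

definition pair_scale ::
    "('k \<Rightarrow> 'a \<Rightarrow> 'a) \<Rightarrow> 'k \<Rightarrow> ('a list \<Rightarrow> 'a) \<times> ('a list \<Rightarrow> 'a) \<Rightarrow> ('a list \<Rightarrow> 'a) \<times> ('a list \<Rightarrow> 'a)" where
  "pair_scale scale c x = ((\<lambda>xs. scale c (fst x xs)), (\<lambda>xs. scale c (snd x xs)))"

definition ksgn :: "int \<Rightarrow> 'v::ab_group_add \<Rightarrow> 'v" where
  "ksgn e x = (if even e then x else - x)"  \<comment> \<open>\<open>(-1)\<^sup>e x\<close>\<close>


section \<open>The cochain complex of a Nijenhuis associative algebra\<close>

text \<open>The common shape of \<open>\<delta>_Alg\<close> and \<open>\<partial>\<close>: the outer terms act through \<open>l\<close> and \<open>r\<close>, the inner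
  terms multiply neighbours with \<open>b\<close>. Lists are indexed from 0.\<close>

definition hoch ::
    "('a \<Rightarrow> 'a \<Rightarrow> 'a) \<Rightarrow> ('a \<Rightarrow> 'a \<Rightarrow> 'a) \<Rightarrow> ('a \<Rightarrow> 'a \<Rightarrow> 'a) \<Rightarrow> nat \<Rightarrow>
     ('a list \<Rightarrow> 'a::ab_group_add) \<Rightarrow> 'a list \<Rightarrow> 'a" where
  "hoch l b r n f = (\<lambda>xs. if length xs = n + 1 then
       l (hd xs) (f (tl xs))
       + (\<Sum>i=1..n. ksgn (int i) (f (take (i - 1) xs @ b (xs ! (i - 1)) (xs ! i) # drop (i + 1) xs)))
       + ksgn (int n + 1) (r (f (butlast xs)) (last xs))
     else 0)"

definition delta_Alg ::
    "('a \<Rightarrow> 'a \<Rightarrow> 'a) \<Rightarrow> nat \<Rightarrow> ('a list \<Rightarrow> 'a::ab_group_add) \<Rightarrow> 'a list \<Rightarrow> 'a" where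
  "delta_Alg m n f = hoch m m m n f"

definition mult_P ::
    "('a \<Rightarrow> 'a \<Rightarrow> 'a) \<Rightarrow> ('a \<Rightarrow> 'a) \<Rightarrow> 'a \<Rightarrow> 'a \<Rightarrow> 'a::ab_group_add" where
  "mult_P m P a b = m (P a) b + m a (P b) - P (m a b)"

definition partial_P ::
    "('a \<Rightarrow> 'a \<Rightarrow> 'a) \<Rightarrow> ('a \<Rightarrow> 'a) \<Rightarrow> nat \<Rightarrow> ('a list \<Rightarrow> 'a::ab_group_add) \<Rightarrow> 'a list \<Rightarrow> 'a" where
  "partial_P m P n f = hoch (\<lambda>a x. m (P a) x) (mult_P m P) (\<lambda>x a. m x (P a)) n f"

definition delta_NjO ::
    "('a \<Rightarrow> 'a \<Rightarrow> 'a) \<Rightarrow> ('a \<Rightarrow> 'a) \<Rightarrow> nat \<Rightarrow> ('a list \<Rightarrow> 'a::ab_group_add) \<Rightarrow> 'a list \<Rightarrow> 'a" where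
  "delta_NjO m P n f = - (P \<circ> delta_Alg m n f) + partial_P m P n f"

definition Phi :: "('a \<Rightarrow> 'a) \<Rightarrow> nat \<Rightarrow> ('a list \<Rightarrow> 'a::ab_group_add) \<Rightarrow> 'a list \<Rightarrow> 'a" where
  "Phi P n f = (if n = 0 then f else (\<lambda>xs. if length xs = n then
       (\<Sum>S\<in>Pow {..<n}. ksgn (int (n - card S))
          ((P ^^ (n - card S)) (f (map (\<lambda>i. if i \<in> S then P (xs ! i) else xs ! i) [0..<n]))))
     else 0))"

definition C_NjA ::
    "('k::field \<Rightarrow> 'a::ab_group_add \<Rightarrow> 'a) \<Rightarrow> nat \<Rightarrow> (('a list \<Rightarrow> 'a) \<times> ('a list \<Rightarrow> 'a)) set" where
  "C_NjA scale n = Mlin scale n \<times> (if n = 0 then {0} else Mlin scale (n - 1))"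

definition delta_NjA ::
    "('a \<Rightarrow> 'a \<Rightarrow> 'a) \<Rightarrow> ('a \<Rightarrow> 'a) \<Rightarrow> nat \<Rightarrow>
     ('a list \<Rightarrow> 'a) \<times> ('a list \<Rightarrow> 'a) \<Rightarrow> ('a list \<Rightarrow> 'a) \<times> ('a list \<Rightarrow> 'a::ab_group_add)" where
  "delta_NjA m P n x =
     (delta_Alg m n (fst x),
      - Phi P n (fst x) - (if n = 0 then 0 else delta_NjO m P (n - 1) (snd x)))"

definition sC_NjA ::
    "('k::field \<Rightarrow> 'a \<Rightarrow> 'a) \<Rightarrow> ('a \<Rightarrow> 'a \<Rightarrow> 'a) \<Rightarrow> ('a \<Rightarrow> 'a) \<Rightarrow>
     (('a list \<Rightarrow> 'a::ab_group_add) \<times> ('a list \<Rightarrow> 'a)) graded_complex" where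
  "sC_NjA scale m P = shift_cochain (C_NjA scale) (delta_NjA m P)"

text \<open>The reduced tensor coalgebra starts in tensor degree 1, so the \<open>L\<^sub>\<infinity>\<close>-algebra below has no
  elements of arity 0, whereas \<open>C\<^sup>0_Alg(A)\<close> (in \<open>C\<^sup>0_NjA\<close>) and \<open>C\<^sup>0_NjO(A)\<close> (in \<open>C\<^sup>1_NjA\<close>)
  are copies of \<open>A\<close>. We single out the cochains without component of arity 0; a multilinear map
  can be nonzero at the empty list only if it has arity 0.\<close>

definition sC_NjA_pos ::
    "('k::field \<Rightarrow> 'a \<Rightarrow> 'a) \<Rightarrow> ('a \<Rightarrow> 'a \<Rightarrow> 'a) \<Rightarrow> ('a \<Rightarrow> 'a) \<Rightarrow>
     (('a list \<Rightarrow> 'a::ab_group_add) \<times> ('a list \<Rightarrow> 'a)) graded_complex" where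
  "sC_NjA_pos scale m P =
     \<lparr> cmp = (\<lambda>d. {x \<in> cmp (sC_NjA scale m P) d. fst x [] = 0 \<and> snd x [] = 0}),
       dif = dif (sC_NjA scale m P) \<rparr>"


section \<open>Brace operations\<close>

text \<open>Here \<open>A\<close> sits in degree 0, so \<open>sA\<close> sits in degree 1. A map defined on \<open>(sA)\<^sup>\<otimes>\<^sup>n\<close> is a pair
  \<open>(n, f)\<close>, where \<open>s\<close> is the identity on underlying vectors. The same pair serves for
  \<open>g : (sA)\<^sup>\<otimes>\<^sup>n \<rightarrow> A\<close>, of degree \<open>-n\<close>, and for \<open>sg = s \<circ> g : (sA)\<^sup>\<otimes>\<^sup>n \<rightarrow> sA\<close>, of degree \<open>1 - n\<close>:
  composing with \<open>s\<close> or its inverse on the left produces no Koszul sign.\<close>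

type_synonym 'a op = "nat \<times> ('a list \<Rightarrow> 'a)"

definition deg_sA :: "'a op \<Rightarrow> int" where
  "deg_sA \<phi> = 1 - int (fst \<phi>)"

definition deg_A :: "'a op \<Rightarrow> int" where
  "deg_A \<phi> = - int (fst \<phi>)"

definition id_op :: "'a op" where
  "id_op = (1, hd)"

text \<open>\<open>(\<phi>\<^sub>1 \<otimes> \<dots> \<otimes> \<phi>\<^sub>r)(x\<^sub>1 \<otimes> \<dots> \<otimes> x\<^sub>N)\<close> is, up to sign, the tensor of the values of the \<open>\<phi>\<^sub>i\<close>
  on consecutive blocks. Every argument has degree 1, so moving \<open>\<phi>\<^sub>j\<close> past the block consumed
  by \<open>\<phi>\<^sub>i\<close>, \<open>i < j\<close>, contributes \<open>|\<phi>\<^sub>j|\<close> times the arity of \<open>\<phi>\<^sub>i\<close> to the exponent.\<close>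

fun tensor_vals :: "'a op list \<Rightarrow> 'a list \<Rightarrow> 'a list" where
  "tensor_vals [] xs = []"
| "tensor_vals (\<phi> # \<phi>s) xs = snd \<phi> (take (fst \<phi>) xs) # tensor_vals \<phi>s (drop (fst \<phi>) xs)"

fun tensor_exp :: "'a op list \<Rightarrow> int" where
  "tensor_exp [] = 0"
| "tensor_exp (\<phi> # \<phi>s) = int (fst \<phi>) * (\<Sum>\<psi>\<leftarrow>\<phi>s. deg_sA \<psi>) + tensor_exp \<phi>s"

text \<open>\<open>place [a\<^sub>0, \<dots>, a\<^sub>k] [g\<^sub>1, \<dots>, g\<^sub>k]\<close> is the list of tensor factors of
  \<open>id\<^sup>\<otimes>\<^sup>a\<^sup>0 \<otimes> g\<^sub>1 \<otimes> id\<^sup>\<otimes>\<^sup>a\<^sup>1 \<otimes> \<dots> \<otimes> g\<^sub>k \<otimes> id\<^sup>\<otimes>\<^sup>a\<^sup>k\<close>.\<close>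

fun place :: "nat list \<Rightarrow> 'a op list \<Rightarrow> 'a op list" where
  "place (a # as) (g # gs) = replicate a id_op @ g # place as gs"
| "place (a # as) [] = replicate a id_op"
| "place [] gs = gs"

definition brace :: "('a::ab_group_add) op \<Rightarrow> 'a op list \<Rightarrow> 'a op" where
  "brace f gs =
     (let k = length gs; N = fst f + (\<Sum>g\<leftarrow>gs. fst g) - k in
      (N, \<lambda>xs. if length xs = N then
            (\<Sum>as\<in>{as. length as = k + 1 \<and> sum_list as + k = fst f}.
               ksgn (tensor_exp (place as gs)) (snd f (tensor_vals (place as gs) xs)))
          else 0))"

definition gerst :: "('a::ab_group_add) op \<Rightarrow> 'a op \<Rightarrow> 'a list \<Rightarrow> 'a" where
  "gerst f g = snd (brace f [g]) - ksgn (deg_sA f * deg_sA g) (snd (brace g [f]))"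


section \<open>The \<open>L\<^sub>\<infinity>\<close>-algebra\<close>

text \<open>Exponent of \<open>\<chi>(\<sigma>; g\<^sub>1, \<dots>, g\<^sub>n)\<close>: parity of \<open>\<sigma>\<close> plus the Koszul sign exponent of the
  rearrangement \<open>g\<^sub>\<sigma>\<^sub>(\<^sub>1\<^sub>), \<dots>, g\<^sub>\<sigma>\<^sub>(\<^sub>n\<^sub>)\<close>. Indices run over \<open>{..<n}\<close>.\<close>

definition chi_exp :: "(nat \<Rightarrow> nat) \<Rightarrow> 'a op list \<Rightarrow> int" where
  "chi_exp \<sigma> gs = (if evenperm \<sigma> then 0 else 1) +
     (\<Sum>(i, j) | i < j \<and> j < length gs \<and> \<sigma> j < \<sigma> i. deg_A (gs ! \<sigma> i) * deg_A (gs ! \<sigma> j))"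

text \<open>\<open>l\<^sub>n\<^sub>+\<^sub>1(sh \<otimes> g\<^sub>1 \<otimes> \<dots> \<otimes> g\<^sub>n)\<close>, with \<open>hs = [g\<^sub>\<sigma>\<^sub>(\<^sub>1\<^sub>), \<dots>, g\<^sub>\<sigma>\<^sub>(\<^sub>n\<^sub>)]\<close>. Note \<open>deg_sA sh = |h| + 1\<close>.\<close>

definition l_main :: "('a::ab_group_add) op \<Rightarrow> 'a op list \<Rightarrow> 'a list \<Rightarrow> 'a" where
  "l_main sh gs = (let n = length gs in
     \<Sum>\<sigma> | \<sigma> permutes {..<n}.
       let hs = map (\<lambda>i. gs ! \<sigma> i) [0..<n];
           \<eta> = chi_exp \<sigma> gs + int n * deg_sA sh + (\<Sum>k=1..n-1. \<Sum>j<k. deg_A (hs ! j))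
       in ksgn \<eta> (\<Sum>k=0..n.
            let \<xi> = deg_sA sh * (\<Sum>i<k. deg_A (hs ! i) + 1) + int k
            in ksgn \<xi> (snd (foldr (\<lambda>g acc. brace g [acc]) (take k hs) (brace sh (drop k hs))))))"

datatype 'a comp = is_Alg: Alg (op_of: "nat \<times> ('a list \<Rightarrow> 'a)") | is_NjO: NjO (op_of: "nat \<times> ('a list \<Rightarrow> 'a)")

text \<open>The operation \<open>l\<^sub>k\<close> (\<open>k\<close> the length of the list) on tensors of elements each lying in one of
  the two summands; the result is its pair of components.\<close>

definition l_comp :: "('a::ab_group_add) comp list \<Rightarrow> ('a list \<Rightarrow> 'a) \<times> ('a list \<Rightarrow> 'a)" where
  "l_comp xs =
     (if length xs = 2 \<and> list_all is_Alg xs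
      then (gerst (op_of (xs ! 0)) (op_of (xs ! 1)), 0)
      else case dropWhile is_NjO xs of
             Alg sh # ys \<Rightarrow>
               (let us = map op_of (takeWhile is_NjO xs); gs = us @ map op_of ys in
                if list_all is_NjO ys \<and> length gs = fst sh \<and> 1 \<le> fst sh
                then (0, ksgn (deg_sA sh * (\<Sum>g\<leftarrow>us. deg_A g) + int (length us)) (l_main sh gs))
                else 0)
           | _ \<Rightarrow> 0)"

text \<open>The degree \<open>d\<close> part of \<open>Hom(T\<^sup>c(sA), sA) \<oplus> Hom(T\<^sup>c(sA), A)\<close> (reduced \<open>T\<^sup>c\<close>):
  the first summand contributes arity \<open>1 - d\<close>, the second one arity \<open>-d\<close>, as long as these
  are at least 1.\<close>

definition L_NjA ::
    "('k::field \<Rightarrow> 'a::ab_group_add \<Rightarrow> 'a) \<Rightarrow> int \<Rightarrow> (('a list \<Rightarrow> 'a) \<times> ('a list \<Rightarrow> 'a)) set" where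
  "L_NjA scale d =
     (if 1 - d \<ge> 1 then Mlin scale (nat (1 - d)) else {0}) \<times>
     (if - d \<ge> 1 then Mlin scale (nat (- d)) else {0})"

type_synonym 'a hom_elt = "int \<times> (('a list \<Rightarrow> 'a) \<times> ('a list \<Rightarrow> 'a))"  \<comment> \<open>degree and element\<close>

definition comps :: "'a hom_elt \<Rightarrow> 'a comp list" where
  "comps x = [Alg (nat (1 - fst x), fst (snd x)), NjO (nat (- fst x), snd (snd x))]"

definition l_NjA :: "('a::ab_group_add) hom_elt list \<Rightarrow> ('a list \<Rightarrow> 'a) \<times> ('a list \<Rightarrow> 'a)" where
  "l_NjA xs = (\<Sum>cs\<leftarrow>product_lists (map comps xs). l_comp cs)"  \<comment> \<open>multilinear expansion\<close>


section \<open>The twisted complex\<close>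

text \<open>\<open>\<nu> = - s \<circ> m \<circ> (s\<^sup>-\<^sup>1 \<otimes> s\<^sup>-\<^sup>1)\<close>; the inner \<open>ksgn\<close> is the Koszul sign of
  \<open>(s\<^sup>-\<^sup>1 \<otimes> s\<^sup>-\<^sup>1)(sa \<otimes> sb)\<close>, where \<open>|s\<^sup>-\<^sup>1| = -1\<close> and \<open>|sa| = 1\<close>.\<close>

definition nu :: "('a \<Rightarrow> 'a \<Rightarrow> 'a) \<Rightarrow> 'a list \<Rightarrow> 'a::ab_group_add" where
  "nu m = (\<lambda>xs. if length xs = 2 then - ksgn ((- 1) * 1) (m (xs ! 0) (xs ! 1)) else 0)"

definition tau :: "('a \<Rightarrow> 'a) \<Rightarrow> 'a list \<Rightarrow> 'a::ab_group_add" where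
  "tau P = (\<lambda>xs. if length xs = 1 then P (xs ! 0) else 0)"

definition mc_elt :: "('a \<Rightarrow> 'a \<Rightarrow> 'a) \<Rightarrow> ('a \<Rightarrow> 'a) \<Rightarrow> ('a::ab_group_add) hom_elt" where
  "mc_elt m P = (- 1, (nu m, tau P))"

text \<open>The differential \<open>l\<^sub>1\<^sup>\<alpha>\<close>. For each \<open>x\<close> only finitely many summands are nonzero.\<close>

definition twisted_l1 ::
    "('k::field_char_0 \<Rightarrow> 'a \<Rightarrow> 'a) \<Rightarrow> ('a::ab_group_add) hom_elt \<Rightarrow> 'a hom_elt \<Rightarrow>
     ('a list \<Rightarrow> 'a) \<times> ('a list \<Rightarrow> 'a)" where
  "twisted_l1 scale \<alpha> x =
     Sum_any (\<lambda>i::nat. pair_scale scale (inverse (fact i))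
       (ksgn (int (i * (i + 1) div 2)) (l_NjA (replicate i \<alpha> @ [x]))))"

definition twisted_complex ::
    "('k::field_char_0 \<Rightarrow> 'a \<Rightarrow> 'a) \<Rightarrow> ('a::ab_group_add) hom_elt \<Rightarrow>
     (('a list \<Rightarrow> 'a) \<times> ('a list \<Rightarrow> 'a)) graded_complex" where
  "twisted_complex scale \<alpha> =
     \<lparr> cmp = L_NjA scale, dif = (\<lambda>d x. twisted_l1 scale \<alpha> (d, x)) \<rparr>"

end

theory Submission
  imports Defs
begin

text \<open>In homological degree \<open>d\<close>, with \<open>n = 1 - d\<close>, both complexes have the same underlying space
  \<open>Hom(A\<^sup>\<otimes>\<^sup>n, A) \<oplus> Hom(A\<^sup>\<otimes>\<^sup>n\<^sup>-\<^sup>1, A)\<close> without its part of arity 0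
  (\<open>cmp_sC_NjA_pos\<close>), so the theorem compares two differentials.

  In \<open>l\<^sub>i\<^sub>+\<^sub>1(\<alpha>\<^sup>\<otimes>\<^sup>i \<otimes> (f, g))\<close> a tensor of components contributes only if it consists of two
  elements of \<open>C_Alg\<close>, or of one such element of arity \<open>i\<close> and \<open>i\<close> elements of \<open>C_NjO\<close>
  (\<open>l_comp_expansion\<close>). Three contributions remain. For \<open>i = 1\<close> the Gerstenhaber bracket of the
  product with \<open>f\<close> is, up to sign, the Hochschild differential (\<open>gerst_nu\<close>). For \<open>i = 2\<close> the
  product meets one copy of \<open>P\<close> and \<open>g\<close>; the resulting six braces regroup to \<open>\<delta>_NjO(g)\<close>
  up to sign (\<open>l_main_nu_tau\<close>), and it occurs twice, which cancels \<open>1/2!\<close>. For \<open>i = n\<close> the map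
  \<open>f\<close> meets \<open>n\<close> copies of \<open>P\<close>; all permutations contribute the same term, which cancels
  \<open>1/n!\<close>, and the terms with \<open>k\<close> copies of \<open>P\<close> outside and \<open>n - k\<close> inside
  are the summands with \<open>|S| = n - k\<close> of \<open>\<Phi>\<^sup>n(f)\<close> (\<open>l_main_tau\<close>). Hence the twisted differential sends \<open>(f, g)\<close> to
  \<open>((-1)\<^sup>n \<delta>_Alg(f), \<Phi>\<^sup>n(f) + (-1)\<^sup>n \<delta>_NjO(g))\<close> (\<open>twisted_l1_eq\<close>), whereas the
  shifted cochain complex has \<open>(- \<delta>_Alg(f), \<Phi>\<^sup>n(f) + \<delta>_NjO(g))\<close>. Multiplying the two components
  by the signs with exponents \<open>n(n+1)/2\<close> and \<open>n(n-1)/2\<close> intertwines them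
  (\<open>twisted_l1_sign_change\<close>).

  It remains to see that the cochain complex is a complex; the twisted side inherits this
  along the isomorphism. The points are \<open>\<delta>_NjO \<circ> \<delta>_NjO = 0\<close>
  (\<open>list_delta_NjO_list_delta_NjO\<close>), which rests on \<open>m\<close> and the deformed product being
  compatible associative products, and \<open>\<Phi> \<circ> \<delta>_Alg = \<delta>_NjO \<circ> \<Phi>\<close>
  (\<open>list_Phi_list_diff\<close>). Both are proved for functions on lists of arbitrary length by recursion
  on the list: splitting off the first argument turns the alternating sums into two-term
  recursions, and the arity never appears.\<close>

section \<open>The Hochschild differential by recursion on the argument list\<close>

text \<open>The terms of the Hochschild differential other than the outer left one. The recursion reads:
  either the first two arguments are multiplied, or the first argument is a parameter and the
  remaining terms are those of the function with that argument fixed, one sign further.\<close>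

fun tail_diff ::
    "('a \<Rightarrow> 'a \<Rightarrow> 'a) \<Rightarrow> ('a \<Rightarrow> 'a \<Rightarrow> 'a) \<Rightarrow> ('a list \<Rightarrow> 'a::ab_group_add) \<Rightarrow> 'a list \<Rightarrow> 'a" where
  "tail_diff b r f [] = 0"
| "tail_diff b r f [a] = - r (f []) a"
| "tail_diff b r f (a # c # xs) = - f (b a c # xs) - tail_diff b r (\<lambda>ys. f (a # ys)) (c # xs)"

fun head_diff :: "('a \<Rightarrow> 'a \<Rightarrow> 'a) \<Rightarrow> ('a list \<Rightarrow> 'a::ab_group_add) \<Rightarrow> 'a list \<Rightarrow> 'a" where
  "head_diff l f [] = 0"
| "head_diff l f (a # xs) = l a (f xs)"

definition list_diff ::
    "('a \<Rightarrow> 'a \<Rightarrow> 'a) \<Rightarrow> ('a \<Rightarrow> 'a \<Rightarrow> 'a) \<Rightarrow> ('a \<Rightarrow> 'a \<Rightarrow> 'a) \<Rightarrow>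
     ('a list \<Rightarrow> 'a::ab_group_add) \<Rightarrow> 'a list \<Rightarrow> 'a" where
  "list_diff l b r f xs = head_diff l f xs + tail_diff b r f xs"

lemma ksgn_simps [simp]:
  "ksgn e 0 = 0" "even e \<Longrightarrow> ksgn e x = x" "odd e \<Longrightarrow> ksgn e x = - x"
  by (auto simp: ksgn_def)

lemma ksgn_add: "ksgn e (x + y) = ksgn e x + ksgn e y"
  and ksgn_diff: "ksgn e (x - y) = ksgn e x - ksgn e y"
  and ksgn_Suc: "ksgn (1 + int n) x = - ksgn (int n) x"
  by (auto simp: ksgn_def)

lemma tail_diff_eq_sum:
  "length xs = n + 1 \<Longrightarrow> tail_diff b r f xs =
     (\<Sum>i=1..n. ksgn (int i) (f (take (i - 1) xs @ b (xs ! (i - 1)) (xs ! i) # drop (i + 1) xs)))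
     + ksgn (int n + 1) (r (f (butlast xs)) (last xs))"
proof (induction n arbitrary: xs f)
  case 0
  then obtain a where "xs = [a]" by (auto simp: length_Suc_conv)
  then show ?case by simp
next
  case (Suc n)
  then obtain a c zs where xs: "xs = a # c # zs" and len: "length zs = n"
    by (auto simp: length_Suc_conv)
  let ?t = "\<lambda>i. ksgn (int i) (f (take (i - 1) xs @ b (xs ! (i - 1)) (xs ! i) # drop (i + 1) xs))"
  let ?u = "\<lambda>i. ksgn (int i) (f (a # take (i - 1) (c # zs) @ b ((c # zs) ! (i - 1)) ((c # zs) ! i)
      # drop (i + 1) (c # zs)))"
  have "sum ?t {1..Suc n} = ?t 1 + sum ?t {Suc 1..Suc n}"
    by (subst sum.atLeast_Suc_atMost) auto
  also have "sum ?t {Suc 1..Suc n} = (\<Sum>i=1..n. ?t (Suc i))"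
    by (rule sum.shift_bounds_cl_Suc_ivl)
  also have "\<dots> = (\<Sum>i=1..n. - ?u i)"
  proof (rule sum.cong)
    fix i assume "i \<in> {1..n}"
    then obtain j where "i = Suc j" by (cases i) auto
    then show "?t (Suc i) = - ?u i" by (simp add: xs ksgn_def)
  qed simp
  finally have eq: "sum ?t {1..Suc n} = - f (b a c # zs) - sum ?u {1..n}"
    by (simp add: xs sum_negf)
  have IH: "tail_diff b r (\<lambda>ys. f (a # ys)) (c # zs) = sum ?u {1..n}
      + ksgn (int n + 1) (r (f (a # butlast (c # zs))) (last (c # zs)))"
    using Suc.IH[of "c # zs" "\<lambda>ys. f (a # ys)"] len by simp
  have "ksgn (int (Suc n) + 1) (r (f (butlast xs)) (last xs))
      = - ksgn (int n + 1) (r (f (a # butlast (c # zs))) (last (c # zs)))"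
    by (auto simp: xs ksgn_def)
  with eq IH show ?case by (simp add: xs)
qed

lemma hoch_eq_list_diff:
  "hoch l b r n f = (\<lambda>xs. if length xs = n + 1 then list_diff l b r f xs else 0)"
proof
  fix xs :: "'a list"
  show "hoch l b r n f xs = (if length xs = n + 1 then list_diff l b r f xs else 0)"
  proof (cases "length xs = n + 1")
    case True
    then obtain a ys where "xs = a # ys" by (auto simp: length_Suc_conv)
    then show ?thesis
      using True tail_diff_eq_sum[OF True, of b r f] by (simp add: hoch_def list_diff_def add.assoc)
  qed (simp add: hoch_def)
qed

lemma tail_diff_add:
  assumes "\<And>x y a. r (x + y) a = r x a + r y a"
  shows "tail_diff b r (\<lambda>ys. f ys + g ys) xs = tail_diff b r f xs + tail_diff b r g xs"
  by (induction xs arbitrary: f g rule: induct_list012) (simp_all add: assms)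

lemma tail_diff_map:
  assumes "\<And>x a. r (h x) a = h (r x a)" "\<And>x y. h (x + y) = h x + h y"
  shows "tail_diff b r (\<lambda>ys. h (f ys)) xs = h (tail_diff b r f xs)"
proof -
  interpret h: additive h by standard (rule assms)
  show ?thesis
    by (induction xs arbitrary: f rule: induct_list012)
      (simp_all add: assms(1) h.minus h.diff h.zero)
qed

lemma tail_diff_minus:
  assumes "\<And>x a. r (- x) a = - r x a"
  shows "tail_diff b r (\<lambda>ys. - f ys) xs = - tail_diff b r f xs"
  by (rule tail_diff_map) (simp_all add: assms)

text \<open>This is the square of the tail with its first argument \<open>a\<close> split off. Products at disjoint
  places occur twice with opposite signs and overlapping ones cancel by associativity, except
  for the terms in which \<open>a\<close> and \<open>c\<close> are multiplied first: their partners belong to the part that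
  was split off.\<close>

lemma tail_diff_tail_diff:
  assumes r_add: "\<And>x y a. r (x + y) a = r x a + r y a"
    and assoc: "\<And>a c d. b (b a c) d = b a (b c d)"
    and r_act: "\<And>x a c. r (r x a) c = r x (b a c)"
  shows "tail_diff b r (\<lambda>ys. tail_diff b r f (a # ys)) (c # xs) = - tail_diff b r f (b a c # xs)"
proof (induction xs arbitrary: a c f)
  interpret r: additive "\<lambda>x. r x a" for a by standard (rule r_add)
  case Nil
  show ?case by (simp add: r.minus r_act)
next
  interpret r: additive "\<lambda>x. r x a" for a by standard (rule r_add)
  case (Cons d xs)
  have "tail_diff b r (\<lambda>ys. tail_diff b r f (a # c # ys)) (d # xs)
      = - tail_diff b r (\<lambda>ys. f (b a c # ys)) (d # xs)
        - tail_diff b r (\<lambda>ys. tail_diff b r (\<lambda>zs. f (a # zs)) (c # ys)) (d # xs)"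
    using tail_diff_add[of r b "\<lambda>ys. - f (b a c # ys)"
        "\<lambda>ys. - tail_diff b r (\<lambda>zs. f (a # zs)) (c # ys)"]
    by (simp add: r_add tail_diff_minus r.minus)
  then show ?case by (simp add: Cons.IH assoc)
qed

lemma list_diff_add:
  assumes "\<And>x y a. l a (x + y) = l a x + l a y" "\<And>x y a. r (x + y) a = r x a + r y a"
  shows "list_diff l b r (\<lambda>ys. f ys + g ys) xs = list_diff l b r f xs + list_diff l b r g xs"
  by (cases xs) (simp_all add: list_diff_def tail_diff_add assms)

lemma list_diff_diff:
  assumes l_add: "\<And>x y a. l a (x + y) = l a x + l a y"
    and r_add: "\<And>x y a. r (x + y) a = r x a + r y a"
  shows "list_diff l b r (\<lambda>ys. f ys - g ys) xs = list_diff l b r f xs - list_diff l b r g xs"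
  using list_diff_add[where l = l and r = r and b = b and xs = xs and f = "\<lambda>ys. f ys - g ys" and g = g] assms by simp

text \<open>The Hochschild differential squares to zero for coefficients in a bimodule over
  \<open>b\<close>. It is stated for independent actions \<open>l\<close> and \<open>r\<close> and any function on lists, so that
  it applies to every product considered below.\<close>

lemma list_diff_list_diff:
  assumes l_add: "\<And>x y a. l a (x + y) = l a x + l a y"
    and r_add: "\<And>x y a. r (x + y) a = r x a + r y a"
    and assoc: "\<And>a c d. b (b a c) d = b a (b c d)"
    and l_act: "\<And>x a c. l a (l c x) = l (b a c) x"
    and r_act: "\<And>x a c. r (r x a) c = r x (b a c)"
    and l_r: "\<And>x a c. r (l a x) c = l a (r x c)"
  shows "list_diff l b r (list_diff l b r f) xs = 0"
proof -
  interpret l: additive "l a" for a by standard (rule l_add)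
  interpret r: additive "\<lambda>x. r x a" for a by standard (rule r_add)
  consider "xs = []" | a where "xs = [a]" | a c ys where "xs = a # c # ys"
    by (metis neq_Nil_conv)
  then show ?thesis
  proof cases
    case (3 a c ys)
    have "tail_diff b r (\<lambda>ys. l a (f ys) + tail_diff b r f (a # ys)) (c # ys)
        = l a (tail_diff b r f (c # ys)) - tail_diff b r f (b a c # ys)"
      by (simp add: tail_diff_add r_add tail_diff_tail_diff assoc r_act
          tail_diff_map[where h = "l a"] l_r l_add)
    then show ?thesis by (simp add: 3 list_diff_def l_add l_act)
  qed (simp_all add: list_diff_def l.zero r.zero)
qed

section \<open>Multilinearity is preserved\<close>

definition multilinear :: "('k::field \<Rightarrow> 'a::ab_group_add \<Rightarrow> 'a) \<Rightarrow> ('a list \<Rightarrow> 'a) \<Rightarrow> bool" where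
  "multilinear scale f \<longleftrightarrow> (\<forall>xs ys. Vector_Spaces.linear scale scale (\<lambda>x. f (xs @ x # ys)))"

text \<open>\<open>\<Phi>\<close> with the sum over subsets organised by whether the first argument belongs to the
  subset: if so it is replaced by its image under \<open>P\<close>, otherwise \<open>- P\<close> is applied outside.\<close>

fun list_Phi :: "('a \<Rightarrow> 'a) \<Rightarrow> ('a list \<Rightarrow> 'a::ab_group_add) \<Rightarrow> 'a list \<Rightarrow> 'a" where
  "list_Phi P f [] = f []"
| "list_Phi P f (x # xs) = list_Phi P (\<lambda>ys. f (P x # ys)) xs - P (list_Phi P (\<lambda>ys. f (x # ys)) xs)"

context nijenhuis_algebra
begin

abbreviation lin :: "('a \<Rightarrow> 'a) \<Rightarrow> bool" where
  "lin \<equiv> Vector_Spaces.linear scale scale"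

lemma lin_iff: "lin f \<longleftrightarrow> (\<forall>x y. f (x + y) = f x + f y) \<and> (\<forall>c x. f (scale c x) = scale c (f x))"
  using vector_space_axioms
  by (auto simp: Vector_Spaces.linear_def module_hom_def module_hom_axioms_def module_def vector_space_def)

lemma lin_0: "lin (\<lambda>x. 0)"
  by (simp add: lin_iff)

lemma lin_plus: "lin f \<Longrightarrow> lin g \<Longrightarrow> lin (\<lambda>x. f x + g x)"
  and lin_diff: "lin f \<Longrightarrow> lin g \<Longrightarrow> lin (\<lambda>x. f x - g x)"
  and lin_minus: "lin f \<Longrightarrow> lin (\<lambda>x. - f x)"
  and lin_comp: "lin f \<Longrightarrow> lin g \<Longrightarrow> lin (\<lambda>x. f (g x))"
  by (simp_all add: lin_iff algebra_simps scale_right_diff_distrib scale_right_distrib)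

lemma lin_add: "lin f \<Longrightarrow> f (x + y) = f x + f y"
  and lin_scale: "lin f \<Longrightarrow> f (scale c x) = scale c (f x)"
  by (simp_all add: lin_iff)

lemma lin_neg: "lin f \<Longrightarrow> f (- x) = - f x" and lin_sub: "lin f \<Longrightarrow> f (x - y) = f x - f y"
  and lin_zero: "lin f \<Longrightarrow> f 0 = 0"
proof -
  assume "lin f"
  then interpret additive f by (simp add: additive_def lin_add)
  show "f (- x) = - f x" "f (x - y) = f x - f y" "f 0 = 0"
    by (rule minus diff zero)+
qed

lemma multilinearD: "multilinear scale f \<Longrightarrow> lin (\<lambda>x. f (xs @ x # ys))"
  by (simp add: multilinear_def)

lemma multilinear_hd: "multilinear scale f \<Longrightarrow> lin (\<lambda>x. f (x # ys))"
  using multilinearD[of f "[]" ys] by simp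

lemma multilinear_Cons: "multilinear scale f \<Longrightarrow> multilinear scale (\<lambda>ys. f (a # ys))"
  using multilinearD[of f "a # _"] by (simp add: multilinear_def)

lemma lin_tail_diff:
  assumes "\<And>a. lin (\<lambda>x. r x a)" "\<And>ys. lin (\<lambda>x. F x ys)"
  shows "lin (\<lambda>x. tail_diff b r (F x) xs)"
  using assms(2)
  by (induction xs arbitrary: F rule: induct_list012)
    (simp_all add: lin_0 lin_minus lin_diff lin_comp[OF assms(1)])

lemma multilinear_tail_diff:
  assumes f: "multilinear scale f"
    and b: "\<And>a. lin (b a)" "\<And>a. lin (\<lambda>x. b x a)"
    and r: "\<And>a. lin (r a)" "\<And>a. lin (\<lambda>x. r x a)"
  shows "multilinear scale (tail_diff b r f)"
proof -
  have hd: "lin (\<lambda>x. tail_diff b r f (x # ys))" if f: "multilinear scale f" for f ys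
  proof (cases ys)
    case Nil
    then show ?thesis by (simp add: lin_minus[OF r(1)])
  next
    case (Cons c zs)
    have "lin (\<lambda>x. f (b x c # zs))"
      by (rule lin_comp[OF multilinear_hd[OF f] b(2)])
    moreover have "lin (\<lambda>x. tail_diff b r (\<lambda>ys. f (x # ys)) (c # zs))"
      by (rule lin_tail_diff[OF r(2)]) (rule multilinear_hd[OF f])
    ultimately show ?thesis unfolding Cons tail_diff.simps by (intro lin_minus lin_diff)
  qed
  have "lin (\<lambda>x. tail_diff b r f (xs @ x # ys))" for xs ys
    using f
  proof (induction xs arbitrary: f rule: induct_list012)
    case 1
    from hd[OF 1] show ?case by simp
  next
    case (2 a)
    have "lin (\<lambda>x. f (b a x # ys))"
      by (rule lin_comp[OF multilinear_hd[OF 2] b(1)])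
    with hd[OF multilinear_Cons[OF 2]] show ?case
      unfolding append_Cons append_Nil tail_diff.simps by (intro lin_minus lin_diff)
  next
    case (3 a c zs)
    have "lin (\<lambda>x. tail_diff b r (\<lambda>ys. f (a # ys)) ((c # zs) @ x # ys))"
      by (rule 3) (rule multilinear_Cons[OF 3(3)])
    with multilinearD[OF 3(3), of "b a c # zs" ys] show ?case
      unfolding append_Cons tail_diff.simps by (intro lin_minus lin_diff)
  qed
  then show ?thesis unfolding multilinear_def by blast
qed

lemma multilinear_list_diff:
  assumes f: "multilinear scale f"
    and l: "\<And>a. lin (l a)" "\<And>a. lin (\<lambda>x. l x a)"
    and b: "\<And>a. lin (b a)" "\<And>a. lin (\<lambda>x. b x a)"
    and r: "\<And>a. lin (r a)" "\<And>a. lin (\<lambda>x. r x a)"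
  shows "multilinear scale (list_diff l b r f)"
  unfolding multilinear_def
proof (intro allI)
  fix xs ys
  have "lin (\<lambda>x. head_diff l f (xs @ x # ys))"
    by (cases xs) (simp_all add: l(2) lin_comp[OF l(1) multilinearD[OF f]])
  moreover have "lin (\<lambda>x. tail_diff b r f (xs @ x # ys))"
    by (rule multilinearD, rule multilinear_tail_diff) (rule f b r)+
  ultimately show "lin (\<lambda>x. list_diff l b r f (xs @ x # ys))"
    unfolding list_diff_def by (rule lin_plus)
qed

lemma multilinear_diff:
  "multilinear scale f \<Longrightarrow> multilinear scale g \<Longrightarrow> multilinear scale (\<lambda>xs. f xs - g xs)"
  unfolding multilinear_def by (intro allI lin_diff) blast+

lemma multilinear_plus:
  "multilinear scale f \<Longrightarrow> multilinear scale g \<Longrightarrow> multilinear scale (\<lambda>xs. f xs + g xs)"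
  unfolding multilinear_def by (intro allI lin_plus) blast+

lemma multilinear_comp:
  "lin h \<Longrightarrow> multilinear scale f \<Longrightarrow> multilinear scale (\<lambda>xs. h (f xs))"
  using lin_comp[of h "\<lambda>x. f (_ @ x # _)"] by (simp add: multilinear_def)

lemma tail_diff_add_prod:
  assumes "multilinear scale f"
  shows "tail_diff (\<lambda>x y. b x y + b' x y) (\<lambda>x y. r x y + r' x y) f xs
    = tail_diff b r f xs + tail_diff b' r' f xs"
  using assms
  by (induction xs arbitrary: f rule: induct_list012)
    (simp_all add: lin_add[OF multilinear_hd] multilinear_Cons)

text \<open>The differential is additive in the triple of structure maps. This is how compatibility
  of two products will be turned into an anticommutation relation.\<close>

lemma list_diff_add_prod:
  assumes "multilinear scale f"
  shows "list_diff (\<lambda>x y. l x y + l' x y) (\<lambda>x y. b x y + b' x y) (\<lambda>x y. r x y + r' x y) f xs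
    = list_diff l b r f xs + list_diff l' b' r' f xs"
  by (cases xs) (simp_all add: list_diff_def tail_diff_add_prod assms)

lemma lin_list_Phi:
  assumes "lin P" "\<And>ys. lin (\<lambda>x. F x ys)"
  shows "lin (\<lambda>x. list_Phi P (F x) xs)"
  using assms(2) by (induction xs arbitrary: F) (simp_all add: lin_diff lin_comp[OF assms(1)])

lemma multilinear_list_Phi:
  assumes "lin P" "multilinear scale f"
  shows "multilinear scale (list_Phi P f)"
proof -
  have "lin (\<lambda>x. list_Phi P f (xs @ x # ys))" for xs ys
    using assms(2)
  proof (induction xs arbitrary: f)
    case Nil
    have "lin (\<lambda>x. list_Phi P (\<lambda>ys. f (x # ys)) ys)" "lin (\<lambda>x. list_Phi P (\<lambda>ys. f (P x # ys)) ys)"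
      by (intro lin_list_Phi assms(1) multilinear_hd[OF Nil]
          lin_comp[OF multilinear_hd[OF Nil] assms(1)])+
    then show ?case
      unfolding append_Nil list_Phi.simps by (intro lin_diff lin_comp[OF assms(1)])
  next
    case (Cons a xs)
    show ?case
      unfolding append_Cons list_Phi.simps
      by (intro lin_diff lin_comp[OF assms(1)] Cons.IH multilinear_Cons Cons.prems)
  qed
  then show ?thesis unfolding multilinear_def by blast
qed

lemma list_Phi_add:
  assumes "lin P"
  shows "list_Phi P (\<lambda>ys. f ys + g ys) xs = list_Phi P f xs + list_Phi P g xs"
  by (induction xs arbitrary: f g) (simp_all add: lin_add[OF assms])

lemma list_Phi_minus:
  assumes "lin P"
  shows "list_Phi P (\<lambda>ys. - f ys) xs = - list_Phi P f xs"
  by (induction xs arbitrary: f) (simp_all add: lin_neg[OF assms])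

lemma list_Phi_diff:
  assumes "lin P"
  shows "list_Phi P (\<lambda>ys. f ys - g ys) xs = list_Phi P f xs - list_Phi P g xs"
  using list_Phi_add[OF assms, of f "\<lambda>ys. - g ys"] list_Phi_minus[OF assms] by simp

end

section \<open>The differential on the cochains of the Nijenhuis operator\<close>

context nijenhuis_algebra
begin

lemmas P_dist = lin_add[OF linear_P] lin_sub[OF linear_P] lin_neg[OF linear_P] lin_zero[OF linear_P]
lemmas m_dist =
  lin_add[OF linear_left] lin_sub[OF linear_left] lin_neg[OF linear_left] lin_zero[OF linear_left]
  lin_add[OF linear_right] lin_sub[OF linear_right] lin_neg[OF linear_right] lin_zero[OF linear_right]

abbreviation "mP \<equiv> mult_P m P"
abbreviation "lP \<equiv> \<lambda>a x. m (P a) x"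
abbreviation "rP \<equiv> \<lambda>x a. m x (P a)"

text \<open>The Nijenhuis identity: \<open>P\<close> is multiplicative from the deformed product to \<open>m\<close>.\<close>

lemma P_mult_P: "P (mP a b) = m (P a) (P b)"
  by (simp add: mult_P_def nijenhuis)

lemma lin_lP: "lin (lP a)" "lin (\<lambda>a. lP a x)"
  and lin_rP: "lin (rP x)" "lin (\<lambda>x. rP x a)"
  by (rule linear_right linear_left lin_comp[OF linear_left linear_P]
      lin_comp[OF linear_right linear_P])+

lemma lin_mult_P: "lin (mP a)" "lin (\<lambda>x. mP x a)"
  unfolding mult_P_def[abs_def]
  by (intro lin_plus lin_diff lin_comp[OF linear_P] linear_left linear_right
      lin_comp[OF linear_left linear_P] lin_comp[OF linear_right linear_P])+

lemma mult_P_assoc: "mP (mP a b) c = mP a (mP b c)"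
proof -
  have "m (P (m a b)) (P c) = P (m (P (m a b)) c) + P (m (m a b) (P c)) - P (P (m (m a b) c))"
    "m (P a) (P (m b c)) = P (m (P a) (m b c)) + P (m a (P (m b c))) - P (P (m a (m b c)))"
    by (simp_all add: nijenhuis P_dist)
  then show ?thesis
    unfolding mult_P_def[of m P "mP a b"] mult_P_def[of m P a "mP b c"] P_mult_P
    by (simp add: mult_P_def m_dist P_dist assoc)
qed

text \<open>The two products are compatible: all terms mixing them cancel.\<close>

lemma add_mult_P_assoc:
  defines "b \<equiv> \<lambda>x y. m x y + mP x y"
  shows "b (b x y) z = b x (b y z)"
proof -
  have "m (mP x y) z + mP (m x y) z = m x (mP y z) + mP x (m y z)"
    by (simp add: mult_P_def m_dist assoc)
  then show ?thesis
    by (simp add: b_def m_dist lin_add[OF lin_mult_P(1)] lin_add[OF lin_mult_P(2)] assoc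
        mult_P_assoc algebra_simps)
qed

definition list_delta_NjO :: "('a list \<Rightarrow> 'a) \<Rightarrow> 'a list \<Rightarrow> 'a" where
  "list_delta_NjO f xs = list_diff lP mP rP f xs - P (list_diff m m m f xs)"

definition tail_NjO :: "('a list \<Rightarrow> 'a) \<Rightarrow> 'a list \<Rightarrow> 'a" where
  "tail_NjO f xs = tail_diff mP rP f xs - P (tail_diff m m f xs)"

lemma tail_NjO_simps [simp]:
  "tail_NjO f [] = 0"
  "tail_NjO f [a] = - m (f []) (P a) + P (m (f []) a)"
  "tail_NjO f (a # c # xs)
     = - f (mP a c # xs) + P (f (m a c # xs)) - tail_NjO (\<lambda>ys. f (a # ys)) (c # xs)"
  by (simp_all add: tail_NjO_def P_dist)

abbreviation head_NjO :: "('a list \<Rightarrow> 'a) \<Rightarrow> 'a list \<Rightarrow> 'a" where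
  "head_NjO f xs \<equiv> head_diff lP f xs - P (head_diff m f xs)"

lemma list_delta_NjO_eq: "list_delta_NjO f xs = head_NjO f xs + tail_NjO f xs"
  by (simp add: list_delta_NjO_def tail_NjO_def list_diff_def P_dist)

text \<open>The extra outer terms of the deformed product, \<open>a P(x)\<close> and \<open>P(x) a\<close>, are the outer terms
  of the Hochschild differential of \<open>P \<circ> f\<close>. This writes \<open>\<delta>_NjO\<close> as a difference of two
  Hochschild differentials of associative products.\<close>

lemma list_diff_mult_P_eq_list_delta_NjO:
  "list_diff mP mP mP f xs = list_delta_NjO f xs + list_diff m m m (\<lambda>ys. P (f ys)) xs"
proof -
  have "tail_diff mP mP f xs = tail_NjO f xs + tail_diff m m (\<lambda>ys. P (f ys)) xs"
    by (induction xs arbitrary: f rule: induct_list012)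
      (simp_all add: mult_P_def[of m P "_ []"])
  then show ?thesis
    by (cases xs) (simp_all add: list_delta_NjO_eq list_diff_def mult_P_def P_dist)
qed

lemma tail_NjO_P: "tail_NjO (\<lambda>ys. P (f ys)) xs = P (tail_NjO f xs)"
  by (induction xs arbitrary: f rule: induct_list012) (simp_all add: P_dist nijenhuis)

lemma tail_NjO_diff: "tail_NjO (\<lambda>ys. f ys - g ys) xs = tail_NjO f xs - tail_NjO g xs"
  by (induction xs arbitrary: f g rule: induct_list012) (simp_all add: P_dist m_dist)

lemma list_delta_NjO_P: "list_delta_NjO (\<lambda>ys. P (f ys)) xs = P (list_delta_NjO f xs)"
  unfolding list_delta_NjO_eq tail_NjO_P
  by (cases xs) (simp_all add: P_dist nijenhuis)

lemma multilinear_diff_m: "multilinear scale f \<Longrightarrow> multilinear scale (list_diff m m m f)"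
  by (intro multilinear_list_diff linear_left linear_right)

lemma multilinear_diff_mult_P: "multilinear scale f \<Longrightarrow> multilinear scale (list_diff mP mP mP f)"
  by (intro multilinear_list_diff lin_mult_P)

lemma multilinear_list_delta_NjO: "multilinear scale f \<Longrightarrow> multilinear scale (list_delta_NjO f)"
  unfolding list_delta_NjO_def[abs_def]
  by (intro multilinear_diff multilinear_comp[OF linear_P] multilinear_diff_m
      multilinear_list_diff lin_lP lin_rP lin_mult_P)

lemma list_diff_m_m: "list_diff m m m (list_diff m m m f) xs = 0"
  by (rule list_diff_list_diff) (simp_all add: m_dist assoc)

lemma list_diff_mult_P_mult_P: "list_diff mP mP mP (list_diff mP mP mP f) xs = 0"
  by (rule list_diff_list_diff)
    (simp_all add: mult_P_assoc lin_add[OF lin_mult_P(1)] lin_add[OF lin_mult_P(2)])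

text \<open>Polarisation: \<open>m\<close>, the deformed product and their sum are all associative,
  so the mixed part of the square of the differential of the sum vanishes.\<close>

lemma list_diff_m_mult_P:
  assumes "multilinear scale f"
  shows "list_diff m m m (list_diff mP mP mP f) xs + list_diff mP mP mP (list_diff m m m f) xs = 0"
proof -
  let ?D = "list_diff m m m" and ?E = "list_diff mP mP mP"
  let ?b = "\<lambda>x y. m x y + mP x y"
  let ?F = "list_diff ?b ?b ?b"
  note addP = lin_add[OF lin_mult_P(1)] lin_add[OF lin_mult_P(2)]
  have F: "?F g ys = ?D g ys + ?E g ys" if "multilinear scale g" for g ys
    using that by (rule list_diff_add_prod)
  have "?F (?F f) xs = 0"
    by (rule list_diff_list_diff) (simp_all only: add_mult_P_assoc, simp_all add: m_dist addP)
  also have "?F f = (\<lambda>ys. ?D f ys + ?E f ys)"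
    using F[OF assms] by auto
  also have "?F \<dots> xs = ?D (\<lambda>ys. ?D f ys + ?E f ys) xs + ?E (\<lambda>ys. ?D f ys + ?E f ys) xs"
    by (intro F multilinear_plus multilinear_diff_m multilinear_diff_mult_P assms)
  also have "\<dots> = ?D (?E f) xs + ?E (?D f) xs"
    by (simp add: list_diff_add m_dist addP list_diff_m_m list_diff_mult_P_mult_P)
  finally show ?thesis .
qed

text \<open>Write \<open>D\<close> and \<open>E\<close> for the differentials of \<open>m\<close> and of the deformed product. From
  \<open>\<delta>_NjO f = E f - D (P f)\<close> and the fact that \<open>\<delta>_NjO\<close> commutes with \<open>P\<close>, its square is
  \<open>- (E D + D E)(P f)\<close>.\<close>

lemma list_delta_NjO_list_delta_NjO:
  assumes f: "multilinear scale f"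
  shows "list_delta_NjO (list_delta_NjO f) xs = 0"
proof -
  let ?D = "list_diff m m m" and ?E = "list_diff mP mP mP"
  let ?Pf = "\<lambda>ys. P (f ys)"
  note addP = lin_add[OF lin_mult_P(1)] lin_add[OF lin_mult_P(2)]
  have N: "list_delta_NjO g = (\<lambda>ys. ?E g ys - ?D (\<lambda>zs. P (g zs)) ys)" for g
    by (auto simp: list_diff_mult_P_eq_list_delta_NjO)
  have "list_delta_NjO (list_delta_NjO f) xs
      = ?E (list_delta_NjO f) xs - ?D (list_delta_NjO ?Pf) xs"
    unfolding N[of "list_delta_NjO f"] by (simp add: list_delta_NjO_P[abs_def])
  also have "?E (list_delta_NjO f) xs = - ?E (?D ?Pf) xs"
    unfolding N[of f]
    by (simp add: list_diff_diff addP list_diff_mult_P_mult_P)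
  also have "?D (list_delta_NjO ?Pf) xs = ?D (?E ?Pf) xs"
    unfolding N[of ?Pf]
    by (simp add: list_diff_diff m_dist list_diff_m_m)
  moreover have "?E (?D ?Pf) xs = - ?D (?E ?Pf) xs"
    unfolding eq_neg_iff_add_eq_0 add.commute[of "?E _ _"]
    by (rule list_diff_m_mult_P[OF multilinear_comp[OF linear_P f]])
  ultimately show ?thesis by simp
qed

section \<open>The comparison map is a chain map\<close>

text \<open>The outer left terms of \<open>\<Phi> \<circ> \<delta>_Alg = \<delta>_NjO \<circ> \<Phi>\<close>. Each further argument pushes a \<open>P\<close> past the
  multiplication by \<open>x\<close>, which is the Nijenhuis identity in the form
  \<open>P(x) P(v) - P(x P(v)) = P(P(x) v) - P(P(x v))\<close>.\<close>

lemma list_Phi_head: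
  "list_Phi P (\<lambda>ys. m (P x) (f ys)) xs - P (list_Phi P (\<lambda>ys. m x (f ys)) xs)
     = m (P x) (list_Phi P f xs) - P (m x (list_Phi P f xs))"
proof (induction xs arbitrary: f)
  case (Cons y ys)
  let ?u = "list_Phi P (\<lambda>zs. f (P y # zs)) ys" and ?v = "list_Phi P (\<lambda>zs. f (y # zs)) ys"
  have "list_Phi P (\<lambda>ys. m (P x) (f ys)) (y # ys) - P (list_Phi P (\<lambda>ys. m x (f ys)) (y # ys))
      = (m (P x) ?u - P (m x ?u)) - P (m (P x) ?v - P (m x ?v))"
    unfolding Cons.IH[symmetric] by (simp add: P_dist)
  also have "\<dots> = m (P x) (?u - P ?v) - P (m x (?u - P ?v))"
    by (simp add: P_dist m_dist nijenhuis)
  finally show ?case by simp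
qed simp

text \<open>The remaining terms. Expanding in the first two arguments \<open>x\<close>, \<open>c\<close>, the left side inserts
  \<open>P(x) P(c)\<close>, \<open>P(x) c\<close>, \<open>x P(c)\<close> and \<open>x c\<close>. The right side inserts the deformed product, its image
  \<open>P(x) P(c)\<close> under \<open>P\<close>, and \<open>x c\<close>, \<open>P(x c)\<close>; the two contributions of \<open>P(x c)\<close> cancel.\<close>

lemma list_Phi_tail:
  assumes "multilinear scale f"
  shows "list_Phi P (tail_diff m m f) (x # xs) = tail_NjO (list_Phi P f) (x # xs)"
  using assms
proof (induction xs arbitrary: x f)
  case (Cons c xs)
  note lf = lin_add[OF multilinear_hd[OF Cons.prems]] lin_sub[OF multilinear_hd[OF Cons.prems]]
  let ?g = "\<lambda>a. list_Phi P (\<lambda>ys. f (a # ys))" and ?t = "tail_diff m m"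
  have IH: "list_Phi P (?t (\<lambda>ys. f (a # ys))) (c # xs) = tail_NjO (?g a) (c # xs)" for a
    by (rule Cons.IH) (rule multilinear_Cons[OF Cons.prems])
  have split: "list_Phi P (\<lambda>ys. ?t f (a # ys)) (c # xs)
      = - ?g (m a (P c)) xs + P (?g (m a c) xs) - tail_NjO (?g a) (c # xs)" for a
    unfolding IH[symmetric]
    by (simp add: list_Phi_diff[OF linear_P] list_Phi_minus[OF linear_P] P_dist)
  have "tail_NjO (list_Phi P f) (x # c # xs)
      = - list_Phi P f (mP x c # xs) + P (list_Phi P f (m x c # xs))
        - tail_NjO (\<lambda>ys. ?g (P x) ys - P (?g x ys)) (c # xs)"
    by (simp add: P_dist)
  also have "\<dots> = - list_Phi P f (mP x c # xs) + P (list_Phi P f (m x c # xs))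
        - tail_NjO (?g (P x)) (c # xs) + P (tail_NjO (?g x) (c # xs))"
    unfolding tail_NjO_diff tail_NjO_P by simp
  also have "list_Phi P f (mP x c # xs) = ?g (m (P x) (P c)) xs
      - P (?g (m (P x) c) xs + ?g (m x (P c)) xs - ?g (P (m x c)) xs)"
    by (simp add: P_mult_P)
      (simp add: mult_P_def lf list_Phi_add[OF linear_P] list_Phi_diff[OF linear_P])
  finally show ?case
    using split[of "P x"] split[of x] by (simp add: P_dist)
qed (simp add: P_dist)

lemma list_Phi_list_diff:
  assumes "multilinear scale f"
  shows "list_Phi P (list_diff m m m f) xs = list_delta_NjO (list_Phi P f) xs"
proof (cases xs)
  case (Cons x ys)
  have "list_Phi P (head_diff m f) (x # ys) = head_NjO (list_Phi P f) (x # ys)"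
    using list_Phi_head by simp
  with list_Phi_tail[OF assms] show ?thesis
    unfolding Cons list_delta_NjO_eq list_diff_def[abs_def] list_Phi_add[OF linear_P] by simp
qed (simp add: list_diff_def list_delta_NjO_def P_dist)

end

section \<open>The cochain complex and its shift\<close>

lemma shift_cochain_chain_complex:
  assumes "\<And>n. module.subspace sc (C n)" "module sc"
    and lin: "\<And>n. linear_map_on sc (C n) (C (Suc n)) (\<delta> n)"
    and sq: "\<And>n x. x \<in> C n \<Longrightarrow> \<delta> (Suc n) (\<delta> n x) = 0"
  shows "chain_complex sc (shift_cochain C \<delta>)"
proof -
  interpret module sc by fact
  have Suc: "nat (2 - d) = Suc (nat (1 - d))" if "d \<le> 1" for d
    using that by simp
  have neg: "- x \<in> C n" if "x \<in> C n" for x n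
    using that assms(1) subspace_neg by blast
  have \<delta>: "\<delta> n (x + y) = \<delta> n x + \<delta> n y" "\<delta> n (sc c x) = sc c (\<delta> n x)" "\<delta> n x \<in> C (Suc n)"
    if "x \<in> C n" "y \<in> C n" for x y n c
    using lin[of n] that by (auto simp: linear_map_on_def)
  have neg': "\<delta> n (- x) = - \<delta> n x" if "x \<in> C n" for n x
    using \<delta>(2)[OF that that, of "-1"] by (simp add: scale_minus_left)
  have \<delta>0: "\<delta> n 0 = 0" "0 \<in> C n" for n
    using \<delta>(1)[of 0 n 0] assms(1)[of n] by (simp_all add: subspace_0)
  show ?thesis
    unfolding chain_complex_def
    using assms(1)
    by (auto simp: shift_cochain_def linear_map_on_def subspace_single_0 Suc \<delta> \<delta>0 neg sq
        neg' scale_minus_right)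
qed

lemma subcomplex_of_subspaces:
  assumes L: "chain_complex sc L"
    and sub: "\<And>d. module.subspace sc (cmp K d)" "\<And>d. cmp K d \<subseteq> cmp L d"
    and closed: "\<And>d x. x \<in> cmp K d \<Longrightarrow> dif L d x \<in> cmp K (d - 1)"
    and dif: "dif K = dif L"
  shows "subcomplex sc K L"
proof -
  have "linear_map_on sc (cmp K d) (cmp K (d - 1)) (dif K d)" for d
    using L sub(2)[of d] closed[of _ d]
    by (auto simp: chain_complex_def linear_map_on_def dif subset_iff)
  moreover have "dif K (d - 1) (dif K d x) = 0" if "x \<in> cmp K d" for d x
    using L sub(2)[of d] that by (auto simp: chain_complex_def dif)
  ultimately show ?thesis
    using L sub by (auto simp: subcomplex_def chain_complex_def dif)
qed

lemma linear_map_on_comp: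
  "linear_map_on sc S T f \<Longrightarrow> linear_map_on sc T U g \<Longrightarrow> linear_map_on sc S U (\<lambda>x. g (f x))"
  by (simp add: linear_map_on_def image_subset_iff)

text \<open>With equal underlying spaces and a self-inverse isomorphism, the chain complex property
  of \<open>K\<close> is transported from \<open>L\<close>.\<close>

lemma complex_isomorphic_of_involutions:
  assumes L: "chain_complex sc L" and sc: "module sc"
    and cmp: "cmp K = cmp L"
    and \<phi>: "\<And>d. linear_map_on sc (cmp L d) (cmp L d) (\<phi> d)"
    and inv: "\<And>d x. x \<in> cmp L d \<Longrightarrow> \<phi> d (\<phi> d x) = x"
    and dif: "\<And>d x. x \<in> cmp L d \<Longrightarrow> dif K d x = \<phi> (d - 1) (dif L d (\<phi> d x))"
  shows "complex_isomorphic sc K L"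
proof -
  interpret module sc by fact
  have sub: "subspace (cmp L d)" and Ld: "linear_map_on sc (cmp L d) (cmp L (d - 1)) (dif L d)"
    and sq: "x \<in> cmp L d \<Longrightarrow> dif L (d - 1) (dif L d x) = 0" for d x
    using L by (auto simp: chain_complex_def)
  have \<phi>_in: "\<phi> d x \<in> cmp L d" if "x \<in> cmp L d" for d x
    using \<phi>[of d] that by (auto simp: linear_map_on_def)
  have d_in: "dif L d x \<in> cmp L (d - 1)" if "x \<in> cmp L d" for d x
    using Ld[of d] that by (auto simp: linear_map_on_def)
  have \<phi>0: "\<phi> d 0 = 0" for d
  proof -
    have "\<phi> d (0 + 0) = \<phi> d 0 + \<phi> d 0"
      using \<phi>[of d] subspace_0[OF sub[of d]] unfolding linear_map_on_def by blast
    then show ?thesis by simp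
  qed
  have "linear_map_on sc (cmp L d) (cmp L (d - 1)) (\<lambda>x. \<phi> (d - 1) (dif L d (\<phi> d x)))" for d
    by (rule linear_map_on_comp[OF linear_map_on_comp[OF \<phi> Ld] \<phi>])
  then have "linear_map_on sc (cmp L d) (cmp L (d - 1)) (dif K d)" for d
    unfolding linear_map_on_def
    using dif[of _ d] subspace_add[OF sub[of d]] subspace_scale[OF sub[of d]] by (simp add: image_def)
  moreover have "dif K (d - 1) (dif K d x) = 0" if "x \<in> cmp L d" for d x
    using that by (simp add: dif \<phi>_in d_in inv sq \<phi>0)
  ultimately have "chain_complex sc K"
    using sub by (simp add: chain_complex_def cmp)
  moreover have "bij_betw (\<phi> d) (cmp L d) (cmp L d)" for d
    by (rule bij_betw_byWitness[where f' = "\<phi> d"]) (auto simp: inv \<phi>_in)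
  moreover have "\<phi> (d - 1) (dif K d x) = dif L d (\<phi> d x)" if "x \<in> cmp L d" for d x
    using that by (simp add: dif inv d_in \<phi>_in)
  ultimately show ?thesis
    unfolding complex_isomorphic_def cmp using L \<phi> by blast
qed

text \<open>An element of \<open>Mlin scale n\<close> is linear in each slot on lists of every length, being 0 off
  length \<open>n\<close>; so the identities for functions on lists apply to it.\<close>

lemma Mlin_iff:
  assumes "vector_space scale"
  shows "f \<in> Mlin scale n \<longleftrightarrow> multilinear scale f \<and> (\<forall>xs. length xs \<noteq> n \<longrightarrow> f xs = 0)"
proof safe
  interpret vector_space scale by fact
  have lin0: "Vector_Spaces.linear scale scale (\<lambda>x. 0)"
    using assms by (simp add: Vector_Spaces.linear_def module_hom_def module_hom_axioms_def
        module_def vector_space_def)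
  assume f: "f \<in> Mlin scale n"
  show "multilinear scale f"
    unfolding multilinear_def
  proof (intro allI)
    fix xs ys
    show "Vector_Spaces.linear scale scale (\<lambda>x. f (xs @ x # ys))"
    proof (cases "length (xs @ undefined # ys) = n")
      case True
      moreover from True have "length xs < n" by auto
      ultimately have "Vector_Spaces.linear scale scale (\<lambda>x. f ((xs @ undefined # ys)[length xs := x]))"
        using f unfolding Mlin_def by blast
      then show ?thesis by simp
    next
      case False
      with f have "f (xs @ x # ys) = 0" for x
        by (simp add: Mlin_def)
      with lin0 show ?thesis by simp
    qed
  qed
  show "f xs = 0" if "length xs \<noteq> n" for xs
    using f that by (simp add: Mlin_def)
next
  assume "multilinear scale f" "\<forall>xs. length xs \<noteq> n \<longrightarrow> f xs = 0"
  then show "f \<in> Mlin scale n"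
    by (simp add: Mlin_def multilinear_def upd_conv_take_nth_drop)
qed

lemma sum_Pow_lessThan_Suc:
  fixes F :: "nat set \<Rightarrow> 'b::comm_monoid_add"
  shows "(\<Sum>S\<in>Pow {..<Suc n}. F S) = (\<Sum>S\<in>Pow {..<n}. F (insert 0 (Suc ` S))) + (\<Sum>S\<in>Pow {..<n}. F (Suc ` S))"
proof -
  have "Pow {..<Suc n} = (image Suc ` Pow {..<n}) \<union> (\<lambda>S. insert 0 (Suc ` S)) ` Pow {..<n}"
    unfolding lessThan_Suc_eq_insert_0 Pow_insert image_Pow_surj[OF refl, symmetric] image_image
    by simp
  moreover have "inj_on (image Suc) (Pow {..<n})"
    by (simp add: inj_on_def inj_image_eq_iff)
  moreover have "inj_on (\<lambda>S. insert 0 (Suc ` S)) (Pow {..<n})"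
    by (auto simp: inj_on_def insert_ident inj_image_eq_iff)
  moreover have "(image Suc ` Pow {..<n}) \<inter> (\<lambda>S. insert 0 (Suc ` S)) ` Pow {..<n} = {}"
    by auto
  ultimately show ?thesis
    by (simp add: sum.union_disjoint sum.reindex add.commute)
qed

context nijenhuis_algebra
begin

lemmas in_Mlin_iff = Mlin_iff[OF vector_space_axioms]

lemma multilinear_of_Mlin: "f \<in> Mlin scale n \<Longrightarrow> multilinear scale f"
  and Mlin_arity: "f \<in> Mlin scale n \<Longrightarrow> length xs \<noteq> n \<Longrightarrow> f xs = 0"
  by (simp_all add: in_Mlin_iff)

lemma tail_diff_arity:
  assumes "\<And>xs. length xs \<noteq> n \<Longrightarrow> f xs = 0" "\<And>a. r 0 a = 0" "length xs \<noteq> Suc n"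
  shows "tail_diff b r f xs = 0"
  using assms(1,3)
proof (induction xs arbitrary: f n rule: induct_list012)
  case (3 a c zs)
  then obtain k where "n = Suc k \<or> n = 0" by (metis not0_implies_Suc)
  have "tail_diff b r (\<lambda>ys. f (a # ys)) (c # zs) = 0"
  proof (cases n)
    case 0
    have "f (a # ys) = 0" for ys using 3(3) 0 by simp
    then have *: "(\<lambda>ys. f (a # ys)) = (\<lambda>ys. 0)" by auto
    show ?thesis unfolding * by (rule 3(2)[of "length (c # zs)"]) auto
  next
    case (Suc k)
    then show ?thesis using 3 by (intro 3(2)[of k]) auto
  qed
  with 3 show ?case by simp
qed (simp_all add: assms(2))

lemma list_diff_arity:
  assumes "\<And>xs. length xs \<noteq> n \<Longrightarrow> f xs = 0" "\<And>a. l a 0 = 0" "\<And>a. r 0 a = 0" "length xs \<noteq> Suc n"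
  shows "list_diff l b r f xs = 0"
proof -
  have "tail_diff b r f xs = 0" using assms by (intro tail_diff_arity) auto
  with assms show ?thesis by (cases xs) (simp_all add: list_diff_def)
qed

lemma list_Phi_arity:
  assumes "\<And>xs. length xs \<noteq> n \<Longrightarrow> f xs = 0" "length xs \<noteq> n"
  shows "list_Phi P f xs = 0"
proof -
  have "list_Phi P (\<lambda>ys. f (zs @ ys)) xs = 0" if "length zs + length xs \<noteq> n" for zs
    using that
  proof (induction xs arbitrary: zs)
    case (Cons x xs)
    show ?case
      using Cons.IH[of "zs @ [P x]"] Cons.IH[of "zs @ [x]"] Cons.prems by (simp add: P_dist)
  qed (simp add: assms)
  from this[of "[]"] assms(2) show ?thesis by simp
qed

lemma list_diff_m_arity:
  assumes "f \<in> Mlin scale n" "length xs \<noteq> Suc n"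
  shows "list_diff m m m f xs = 0"
  by (rule list_diff_arity[OF Mlin_arity[OF assms(1)] _ _ assms(2)]) (simp_all add: m_dist)

lemma delta_Alg_eq: "f \<in> Mlin scale n \<Longrightarrow> delta_Alg m n f = list_diff m m m f"
  using list_diff_m_arity by (auto simp: delta_Alg_def hoch_eq_list_diff fun_eq_iff)

lemma list_delta_NjO_arity:
  assumes "f \<in> Mlin scale n" "length xs \<noteq> Suc n"
  shows "list_delta_NjO f xs = 0"
proof -
  have "list_diff lP mP rP f xs = 0" "list_diff m m m f xs = 0"
    using assms by (intro list_diff_arity[of n]; simp add: Mlin_arity m_dist)+
  then show ?thesis by (simp add: list_delta_NjO_def P_dist)
qed

lemma delta_NjO_eq:
  assumes "f \<in> Mlin scale n"
  shows "delta_NjO m P n f = list_delta_NjO f"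
proof
  fix xs
  show "delta_NjO m P n f xs = list_delta_NjO f xs"
  proof (cases "length xs = Suc n")
    case True
    then show ?thesis
      by (simp add: delta_NjO_def delta_Alg_def partial_P_def hoch_eq_list_diff list_delta_NjO_def)
  next
    case False
    then show ?thesis
      by (simp add: delta_NjO_def delta_Alg_def partial_P_def hoch_eq_list_diff
          list_delta_NjO_arity[OF assms] P_dist)
  qed
qed

lemma sum_Pow_eq_list_Phi:
  assumes "length xs = n"
  shows "(\<Sum>S\<in>Pow {..<n}. ksgn (int (n - card S)) ((P ^^ (n - card S))
      (f (map (\<lambda>i. if i \<in> S then P (xs ! i) else xs ! i) [0..<n])))) = list_Phi P f xs"
  using assms
proof (induction xs arbitrary: n f)
  case Nil
  then show ?case by simp
next
  case (Cons x xs)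
  interpret P: additive P by standard (rule P_dist)
  from Cons.prems obtain k where n: "n = Suc k" and k: "length xs = k" by auto
  define T where "T f S = ksgn (int (k - card S)) ((P ^^ (k - card S))
      (f (map (\<lambda>i. if i \<in> S then P (xs ! i) else xs ! i) [0..<k])))"
    for f :: "'a list \<Rightarrow> 'a" and S
  have IH: "(\<Sum>S\<in>Pow {..<k}. T f S) = list_Phi P f xs" for f
    unfolding T_def by (rule Cons.IH) (rule k)
  define F where "F S = ksgn (int (n - card S)) ((P ^^ (n - card S))
      (f (map (\<lambda>i. if i \<in> S then P ((x # xs) ! i) else (x # xs) ! i) [0..<n])))" for S
  have upt: "[0..<n] = 0 # map Suc [0..<k]"
    unfolding n by (simp add: upt_conv_Cons map_Suc_upt del: upt_Suc)
  have fin: "finite S \<and> card S \<le> k" if "S \<in> Pow {..<k}" for S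
    using that card_mono[of "{..<k}" S] finite_subset[of S "{..<k}"] by auto
  have *: "F (insert 0 (Suc ` S)) = T (\<lambda>ys. f (P x # ys)) S" if "S \<in> Pow {..<k}" for S
  proof -
    have "card (insert 0 (Suc ` S)) = Suc (card S)"
      using fin[OF that] by (simp add: card_insert_if card_image)
    then show ?thesis
      unfolding F_def T_def upt by (simp add: n comp_def inj_image_mem_iff cong: if_cong)
  qed
  have **: "F (Suc ` S) = - P (T (\<lambda>ys. f (x # ys)) S)" if "S \<in> Pow {..<k}" for S
  proof -
    have "card (Suc ` S) = card S" by (simp add: card_image)
    then show ?thesis
      using fin[OF that] unfolding F_def T_def upt
      by (simp add: n comp_def inj_image_mem_iff Suc_diff_le ksgn_def P.minus cong: if_cong)
  qed
  have "(\<Sum>S\<in>Pow {..<n}. F S) = list_Phi P (\<lambda>ys. f (P x # ys)) xs - P (list_Phi P (\<lambda>ys. f (x # ys)) xs)"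
    unfolding n sum_Pow_lessThan_Suc using * **
    by (simp add: IH[symmetric] P.sum sum_negf)
  then show ?case by (simp add: F_def)
qed

lemma Phi_eq:
  assumes "f \<in> Mlin scale n"
  shows "Phi P n f = list_Phi P f"
proof
  fix xs
  show "Phi P n f xs = list_Phi P f xs"
  proof (cases "length xs = n")
    case True
    then show ?thesis
      using sum_Pow_eq_list_Phi[OF True, of f] by (auto simp: Phi_def)
  next
    case False
    then show ?thesis
      using Mlin_arity[OF assms False] list_Phi_arity[OF Mlin_arity[OF assms] False]
      by (simp add: Phi_def)
  qed
qed

lemma delta_Alg_Mlin: "f \<in> Mlin scale n \<Longrightarrow> delta_Alg m n f \<in> Mlin scale (Suc n)"
  by (simp add: in_Mlin_iff[of _ "Suc n"] delta_Alg_eq multilinear_diff_m multilinear_of_Mlin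
      list_diff_m_arity)

lemma delta_NjO_Mlin: "f \<in> Mlin scale n \<Longrightarrow> delta_NjO m P n f \<in> Mlin scale (Suc n)"
  by (simp add: in_Mlin_iff[of _ "Suc n"] delta_NjO_eq multilinear_list_delta_NjO multilinear_of_Mlin
      list_delta_NjO_arity)

lemma Phi_Mlin: "f \<in> Mlin scale n \<Longrightarrow> Phi P n f \<in> Mlin scale n"
  using list_Phi_arity[of n f] Mlin_arity[of f n]
  by (simp add: in_Mlin_iff[of "list_Phi P f"] Phi_eq multilinear_list_Phi[OF linear_P]
      multilinear_of_Mlin)

lemma module_pair_scale: "module (pair_scale scale)"
  by (simp add: module_def pair_scale_def prod_eq_iff fun_eq_iff scale_right_distrib
      scale_left_distrib)

lemma Mlin_0: "0 \<in> Mlin scale n"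
  and Mlin_add: "f \<in> Mlin scale n \<Longrightarrow> g \<in> Mlin scale n \<Longrightarrow> f + g \<in> Mlin scale n"
  and Mlin_scale: "f \<in> Mlin scale n \<Longrightarrow> (\<lambda>xs. scale c (f xs)) \<in> Mlin scale n"
  and Mlin_minus: "f \<in> Mlin scale n \<Longrightarrow> - f \<in> Mlin scale n"
  by (simp_all add: in_Mlin_iff multilinear_def lin_iff scale_right_distrib mult.commute)

lemma Mlin_diff: "f \<in> Mlin scale n \<Longrightarrow> g \<in> Mlin scale n \<Longrightarrow> f - g \<in> Mlin scale n"
  using Mlin_add[OF _ Mlin_minus, of f n g] by simp

lemma subspace_C_NjA: "module.subspace (pair_scale scale) (C_NjA scale n)"
proof -
  interpret pair: module "pair_scale scale" by (rule module_pair_scale)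
  show ?thesis
    unfolding pair.subspace_def
    by (auto simp: C_NjA_def pair_scale_def zero_prod_def Mlin_0 intro: Mlin_add Mlin_scale)
qed

lemma list_diff_scale:
  assumes "\<And>a. lin (l a)" "\<And>a. lin (\<lambda>x. r x a)"
  shows "list_diff l b r (\<lambda>ys. scale c (f ys)) xs = scale c (list_diff l b r f xs)"
proof -
  have "tail_diff b r (\<lambda>ys. scale c (f ys)) xs = scale c (tail_diff b r f xs)"
    by (rule tail_diff_map) (simp_all add: lin_scale[OF assms(2)] scale_right_distrib)
  then show ?thesis
    by (cases xs) (simp_all add: list_diff_def lin_scale[OF assms(1)] scale_right_distrib)
qed

lemma list_delta_NjO_add:
  "list_delta_NjO (\<lambda>ys. f ys + g ys) xs = list_delta_NjO f xs + list_delta_NjO g xs"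
  by (simp add: list_delta_NjO_def list_diff_add m_dist P_dist)

lemma list_delta_NjO_scale:
  "list_delta_NjO (\<lambda>ys. scale c (f ys)) xs = scale c (list_delta_NjO f xs)"
  by (simp add: list_delta_NjO_def list_diff_scale linear_left linear_right lin_lP lin_rP
      lin_scale[OF linear_P] scale_right_diff_distrib)

lemma list_Phi_scale: "list_Phi P (\<lambda>ys. scale c (f ys)) xs = scale c (list_Phi P f xs)"
  by (induction xs arbitrary: f) (simp_all add: lin_scale[OF linear_P] scale_right_diff_distrib)

lemma delta_Alg_add:
  "f \<in> Mlin scale n \<Longrightarrow> g \<in> Mlin scale n \<Longrightarrow> delta_Alg m n (f + g) = delta_Alg m n f + delta_Alg m n g"
  and delta_Alg_scale: "f \<in> Mlin scale n \<Longrightarrow>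
     delta_Alg m n (\<lambda>xs. scale c (f xs)) = (\<lambda>xs. scale c (delta_Alg m n f xs))"
  by (simp_all add: delta_Alg_eq Mlin_add[unfolded plus_fun_def] Mlin_scale fun_eq_iff list_diff_add list_diff_scale
      linear_left linear_right m_dist plus_fun_def)

lemma delta_NjO_add:
  "f \<in> Mlin scale n \<Longrightarrow> g \<in> Mlin scale n \<Longrightarrow>
     delta_NjO m P n (f + g) = delta_NjO m P n f + delta_NjO m P n g"
  and delta_NjO_scale: "f \<in> Mlin scale n \<Longrightarrow>
     delta_NjO m P n (\<lambda>xs. scale c (f xs)) = (\<lambda>xs. scale c (delta_NjO m P n f xs))"
  by (simp_all add: delta_NjO_eq Mlin_add[unfolded plus_fun_def] Mlin_scale fun_eq_iff list_delta_NjO_add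
      list_delta_NjO_scale plus_fun_def)

lemma Phi_add:
  "f \<in> Mlin scale n \<Longrightarrow> g \<in> Mlin scale n \<Longrightarrow> Phi P n (f + g) = Phi P n f + Phi P n g"
  and Phi_scale: "f \<in> Mlin scale n \<Longrightarrow> Phi P n (\<lambda>xs. scale c (f xs)) = (\<lambda>xs. scale c (Phi P n f xs))"
  by (simp_all add: Phi_eq Mlin_add[unfolded plus_fun_def] Mlin_scale fun_eq_iff list_Phi_add[OF linear_P] list_Phi_scale
      plus_fun_def)

lemma delta_NjO_uminus:
  "f \<in> Mlin scale n \<Longrightarrow> delta_NjO m P n (- f) = - delta_NjO m P n f"
  using delta_NjO_add[of f n "- f"] delta_NjO_add[of 0 n 0]
  by (simp add: Mlin_minus Mlin_0 eq_neg_iff_add_eq_0 add.commute)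

lemma delta_Alg_delta_Alg:
  assumes "f \<in> Mlin scale n" shows "delta_Alg m (Suc n) (delta_Alg m n f) = 0"
  using delta_Alg_eq[OF delta_Alg_Mlin[OF assms]]
  by (simp add: delta_Alg_eq[OF assms] fun_eq_iff list_diff_m_m)

lemma delta_NjO_delta_NjO:
  assumes "f \<in> Mlin scale n" shows "delta_NjO m P (Suc n) (delta_NjO m P n f) = 0"
  using delta_NjO_eq[OF delta_NjO_Mlin[OF assms]]
  by (simp add: delta_NjO_eq[OF assms] fun_eq_iff list_delta_NjO_list_delta_NjO
      multilinear_of_Mlin[OF assms])

lemma Phi_delta_Alg:
  assumes "f \<in> Mlin scale n" shows "Phi P (Suc n) (delta_Alg m n f) = delta_NjO m P n (Phi P n f)"
  using Phi_eq[OF delta_Alg_Mlin[OF assms]] delta_NjO_eq[OF Phi_Mlin[OF assms]]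
  by (simp add: delta_Alg_eq[OF assms] Phi_eq[OF assms] fun_eq_iff
      list_Phi_list_diff[OF multilinear_of_Mlin[OF assms]])

lemma delta_NjA_linear: "linear_map_on (pair_scale scale) (C_NjA scale n) (C_NjA scale (Suc n)) (delta_NjA m P n)"
proof (cases n)
  case 0
  then show ?thesis
    by (auto simp: linear_map_on_def C_NjA_def delta_NjA_def pair_scale_def delta_Alg_add
        delta_Alg_scale Phi_add Phi_scale fun_eq_iff scale_minus_right
        intro!: delta_Alg_Mlin[of _ 0, simplified] Mlin_minus Phi_Mlin)
next
  case (Suc k)
  then show ?thesis
    by (auto simp: linear_map_on_def C_NjA_def delta_NjA_def pair_scale_def delta_Alg_add
        delta_Alg_scale Phi_add Phi_scale delta_NjO_add delta_NjO_scale fun_eq_iff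
        scale_minus_right scale_right_diff_distrib
        intro!: delta_Alg_Mlin Mlin_minus Mlin_diff Phi_Mlin delta_NjO_Mlin)
qed

lemma delta_NjA_delta_NjA:
  assumes "x \<in> C_NjA scale n"
  shows "delta_NjA m P (Suc n) (delta_NjA m P n x) = 0"
proof -
  obtain f g where x: "x = (f, g)" by (cases x)
  with assms have f: "f \<in> Mlin scale n" by (auto simp: C_NjA_def)
  show ?thesis
  proof (cases n)
    case 0
    then show ?thesis
      using f by (simp add: x delta_NjA_def delta_Alg_delta_Alg Phi_delta_Alg[of _ 0, simplified]
          delta_Alg_delta_Alg[of _ 0, simplified] delta_NjO_uminus Phi_Mlin zero_prod_def)
  next
    case (Suc k)
    with assms have g: "g \<in> Mlin scale k" by (auto simp: x C_NjA_def)
    have "delta_NjO m P n (- Phi P n f - delta_NjO m P k g)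
        = - delta_NjO m P n (Phi P n f) - delta_NjO m P n (delta_NjO m P k g)"
      using delta_NjO_add[of "- Phi P n f" n "- delta_NjO m P k g"]
      using Phi_Mlin[OF f] delta_NjO_Mlin[OF g] Suc by (simp add: Mlin_minus delta_NjO_uminus)
    then show ?thesis
      using f g Suc by (simp add: x delta_NjA_def delta_Alg_delta_Alg Phi_delta_Alg
          delta_NjO_delta_NjO zero_prod_def)
  qed
qed

lemma chain_complex_sC_NjA: "chain_complex (pair_scale scale) (sC_NjA scale m P)"
  unfolding sC_NjA_def
  by (intro shift_cochain_chain_complex subspace_C_NjA module_pair_scale delta_NjA_linear
      delta_NjA_delta_NjA)

lemma subcomplex_sC_NjA_pos:
  "subcomplex (pair_scale scale) (sC_NjA_pos scale m P) (sC_NjA scale m P)"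
proof (rule subcomplex_of_subspaces[OF chain_complex_sC_NjA])
  interpret pair: module "pair_scale scale" by (rule module_pair_scale)
  fix d
  have "pair.subspace (cmp (sC_NjA scale m P) d)"
    using chain_complex_sC_NjA by (simp add: chain_complex_def)
  then show "pair.subspace (cmp (sC_NjA_pos scale m P) d)"
    unfolding pair.subspace_def by (simp add: sC_NjA_pos_def pair_scale_def)
next
  fix d x assume x: "x \<in> cmp (sC_NjA_pos scale m P) d"
  then have "dif (sC_NjA scale m P) d x \<in> cmp (sC_NjA scale m P) (d - 1)"
    using chain_complex_sC_NjA unfolding chain_complex_def linear_map_on_def sC_NjA_pos_def
    by auto blast
  moreover have "delta_Alg m n f [] = 0" "delta_NjO m P n f [] = 0" for n f
    by (simp_all add: delta_NjO_def delta_Alg_def partial_P_def hoch_def P_dist)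
  moreover have "Phi P n f [] = 0" if "f [] = 0" for f :: "'a list \<Rightarrow> 'a" and n
    using that by (simp add: Phi_def)
  ultimately show "dif (sC_NjA scale m P) d x \<in> cmp (sC_NjA_pos scale m P) (d - 1)"
    using x by (auto simp: sC_NjA_pos_def sC_NjA_def shift_cochain_def delta_NjA_def)
qed (auto simp: sC_NjA_pos_def)

text \<open>Removing the values at the empty list removes \<open>C\<^sup>0_Alg\<close> in degree 1 and \<open>C\<^sup>0_NjO\<close> in degree 0,
  the two places where the cochains exceed the \<open>L\<^sub>\<infinity>\<close>-algebra.\<close>

lemma cmp_sC_NjA_pos: "cmp (sC_NjA_pos scale m P) = L_NjA scale"
proof
  fix d :: int
  have nil: "f [] = 0" if "f \<in> Mlin scale n" "n \<noteq> 0" for f n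
    using Mlin_arity[OF that(1)] that(2) by simp
  have zero: "f = 0" if "f \<in> Mlin scale 0" "f [] = 0" for f
  proof
    fix xs show "f xs = 0 xs" using Mlin_arity[OF that(1)] that(2) by (cases xs) auto
  qed
  consider "d > 1" | "d = 1" | "d = 0" | "d < 0" by linarith
  then show "cmp (sC_NjA_pos scale m P) d = L_NjA scale d"
  proof cases
    case 4
    then have "nat (1 - d) - 1 = nat (- d)" "nat (- d) \<noteq> 0" "nat (1 - d) \<noteq> 0" by auto
    with 4 show ?thesis
      by (auto simp: sC_NjA_pos_def sC_NjA_def shift_cochain_def C_NjA_def L_NjA_def intro: nil)
  qed (auto simp: sC_NjA_pos_def sC_NjA_def shift_cochain_def C_NjA_def L_NjA_def zero_prod_def
      Mlin_0 intro: nil zero)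
qed

lemma cmp_sC_NjA_pos_negative:
  assumes "d < 0"
  shows "cmp (sC_NjA_pos scale m P) d = cmp (sC_NjA scale m P) d"
proof -
  have "f [] = 0" if "f \<in> Mlin scale n" "n \<noteq> 0" for f n
    using Mlin_arity[OF that(1)] that(2) by simp
  then show ?thesis
    using assms by (auto simp: sC_NjA_pos_def sC_NjA_def shift_cochain_def C_NjA_def)
qed

end

section \<open>The parity of a permutation counts its inversions\<close>

definition inversions :: "nat \<Rightarrow> (nat \<Rightarrow> nat) \<Rightarrow> (nat \<times> nat) set" where
  "inversions n \<sigma> = {(i, j). i < j \<and> j < n \<and> \<sigma> j < \<sigma> i}"

lemma finite_inversions: "finite (inversions n \<sigma>)"
  by (rule finite_subset[of _ "{..<n} \<times> {..<n}"]) (auto simp: inversions_def)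

lemma even_card_sym_diff:
  assumes "finite A" "finite B"
  shows "even (card ((A - B) \<union> (B - A))) \<longleftrightarrow> (even (card A) \<longleftrightarrow> even (card B))"
proof -
  have "card ((A - B) \<union> (B - A)) = card (A - B) + card (B - A)"
    using assms by (intro card_Un_disjoint) auto
  moreover have "card A = card (A \<inter> B) + card (A - B)" "card B = card (A \<inter> B) + card (B - A)"
    using card_Int_Diff[OF assms(1), of B] card_Int_Diff[OF assms(2), of A] by (simp_all add: Int_commute)
  ultimately show ?thesis by auto
qed

lemma odd_card_inversions_transpose:
  assumes "a \<noteq> b" "a < n" "b < n"
  shows "odd (card (inversions n (Transposition.transpose a b)))"
  using assms
proof (induction a b rule: linorder_wlog)
  case (le a b)
  then have ab: "a < b" by simp
  have "inversions n (Transposition.transpose a b)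
      = insert (a, b) ({a} \<times> {a<..<b} \<union> {a<..<b} \<times> {b})"
  proof (rule set_eqI)
    fix x :: "nat \<times> nat"
    obtain i j where x: "x = (i, j)" by (cases x)
    have "i < j \<and> j < n \<and> Transposition.transpose a b j < Transposition.transpose a b i \<longleftrightarrow>
        (i = a \<and> j = b) \<or> (i = a \<and> a < j \<and> j < b) \<or> (a < i \<and> i < b \<and> j = b)"
      using ab le(2-4) unfolding Transposition.transpose_def
      by (cases "i = a"; cases "i = b"; cases "j = a"; cases "j = b"; simp; linarith)
    then show "x \<in> inversions n (Transposition.transpose a b) \<longleftrightarrow>
        x \<in> insert (a, b) ({a} \<times> {a<..<b} \<union> {a<..<b} \<times> {b})"
      by (simp add: x inversions_def)
  qed
  moreover have "card ({a} \<times> {a<..<b} \<union> {a<..<b} \<times> {b}) = 2 * card {a<..<b}"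
    by (subst card_Un_disjoint) (auto simp: card_cartesian_product)
  ultimately show ?case by simp
next
  case (sym a b)
  then show ?case by (simp add: transpose_commute)
qed

text \<open>A pair is an inversion of \<open>t \<circ> p\<close> iff exactly one of the following holds: \<open>p\<close> inverts
  it, or \<open>t\<close> inverts its image under \<open>p\<close>. Sorting the image pairs identifies the second set with
  the inversions of \<open>t\<close>, so the inversion counts add modulo 2.\<close>

lemma even_card_inversions_comp:
  assumes p: "p permutes {..<n}" and t: "t permutes {..<n}"
  shows "even (card (inversions n (t \<circ> p))) \<longleftrightarrow>
    (even (card (inversions n p)) \<longleftrightarrow> even (card (inversions n t)))"
proof -
  define E where "E = {(i, j). i < j \<and> j < n \<and> ((p i < p j) \<noteq> (t (p i) < t (p j)))}"
  have inj: "p i = p j \<longleftrightarrow> i = j" "t i = t j \<longleftrightarrow> i = j" for i j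
    using permutes_inj[OF p] permutes_inj[OF t] by (auto simp: inj_eq)
  have range: "p i < n \<longleftrightarrow> i < n" "inv p i < n \<longleftrightarrow> i < n" for i
    using permutes_in_image[OF p, of i] permutes_in_image[OF permutes_inv[OF p], of i] by auto
  have inv: "inv p (p i) = i" "p (inv p i) = i" for i
    using permutes_inverses[OF p] by auto
  have inj': "inv p i = inv p j \<longleftrightarrow> i = j" for i j
    using permutes_inj[OF permutes_inv[OF p]] by (simp add: inj_eq)
  have fin: "finite E"
    by (rule finite_subset[of _ "{..<n} \<times> {..<n}"]) (auto simp: E_def)
  have "inversions n (t \<circ> p) = (inversions n p - E) \<union> (E - inversions n p)"
  proof -
    have "t (p j) < t (p i) \<longleftrightarrow> (p j < p i) \<noteq> ((p i < p j) \<noteq> (t (p i) < t (p j)))" if "i < j" for i j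
      using inj[of i j] inj(2)[of "p i" "p j"] that by auto
    then have "(i, j) \<in> inversions n (t \<circ> p) \<longleftrightarrow> ((i, j) \<in> inversions n p) \<noteq> ((i, j) \<in> E)" for i j
      unfolding inversions_def E_def mem_Collect_eq prod.case comp_apply by blast
    then show ?thesis by fast
  qed
  moreover have "card E = card (inversions n t)"
  proof -
    define F where "F q = (\<lambda>(i, j). (min (q i) (q j), max (q i) (q j)))" for q :: "nat \<Rightarrow> nat"
    have "bij_betw (F p) E (inversions n t)"
    proof (rule bij_betw_byWitness[where f' = "F (inv p)"])
      have F_F: "F q (F q' (i, j)) = (i, j)" if "i < j" "\<And>i. q (q' i) = i" for q q' i j
        using that by (cases "q' i < q' j") (simp_all add: F_def)
      show "\<forall>x\<in>E. F (inv p) (F p x) = x"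
        unfolding E_def by clarify (rule F_F, simp, rule inv)
      show "\<forall>x\<in>inversions n t. F p (F (inv p) x) = x"
        unfolding inversions_def by clarify (rule F_F, simp, rule inv)
      show "F p ` E \<subseteq> inversions n t"
      proof (rule image_subsetI)
        fix x assume "x \<in> E"
        then obtain i j where x: "x = (i, j)" and ij: "(i, j) \<in> E" by (cases x) auto
        then have "p i \<noteq> p j" "t (p i) \<noteq> t (p j)" "p i < n" "p j < n"
          by (auto simp: E_def inj range)
        with ij show "F p x \<in> inversions n t"
          by (cases "p i < p j") (auto simp: x E_def F_def inversions_def)
      qed
      show "F (inv p) ` inversions n t \<subseteq> E"
      proof (rule image_subsetI)
        fix x assume "x \<in> inversions n t"
        then obtain i j where x: "x = (i, j)" and ij: "(i, j) \<in> inversions n t" by (cases x) auto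
        then have "inv p i \<noteq> inv p j" "inv p i < n" "inv p j < n"
          by (auto simp: inversions_def inj' range)
        with ij show "F (inv p) x \<in> E"
          by (cases "inv p i < inv p j") (auto simp: x E_def F_def inversions_def inv)
      qed
    qed
    then show ?thesis by (rule bij_betw_same_card)
  qed
  ultimately show ?thesis
    using even_card_sym_diff[OF finite_inversions[of n p] fin] by simp
qed

text \<open>Each copy of \<open>\<tau>\<close> has odd degree, so its Koszul sign under a permutation counts inversions;
  this lemma makes it cancel the sign of the permutation.\<close>

lemma evenperm_iff_even_inversions:
  assumes "\<sigma> permutes {..<n}"
  shows "evenperm \<sigma> \<longleftrightarrow> even (card (inversions n \<sigma>))"
  using assms finite_lessThan
proof (induction rule: permutes_induct)
  case id
  have "inversions n (\<lambda>a. a) = {}" by (auto simp: inversions_def)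
  then show ?case by (simp add: id_def)
next
  case (swap a b p)
  have "Transposition.transpose a b permutes {..<n}"
    using swap by (intro permutes_swap_id) auto
  moreover have "permutation p" "permutation (Transposition.transpose a b)"
    using permutes_imp_permutation[of "{..<n}" p] swap permutation_swap_id by auto
  ultimately show ?case
    unfolding evenperm_comp[OF \<open>permutation (Transposition.transpose a b)\<close> \<open>permutation p\<close>]
      even_card_inversions_comp[OF \<open>p permutes {..<n}\<close> \<open>Transposition.transpose a b permutes {..<n}\<close>]
    using swap odd_card_inversions_transpose[of a b n] by (simp add: evenperm_swap)
qed


section \<open>Evaluating small braces\<close>

lemma fst_brace: "fst (brace f gs) = fst f + (\<Sum>g\<leftarrow>gs. fst g) - length gs"
  by (simp add: brace_def Let_def)

lemma brace_arity: "length xs \<noteq> fst f + (\<Sum>g\<leftarrow>gs. fst g) - length gs \<Longrightarrow> snd (brace f gs) xs = 0"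
  by (simp add: brace_def Let_def)

lemma id_op_simps [simp]: "fst id_op = 1" "deg_sA id_op = 0"
  by (simp_all add: id_op_def deg_sA_def)

lemma tensor_vals_append:
  "tensor_vals (\<phi>s @ \<psi>s) xs
     = tensor_vals \<phi>s (take (\<Sum>\<phi>\<leftarrow>\<phi>s. fst \<phi>) xs) @ tensor_vals \<psi>s (drop (\<Sum>\<phi>\<leftarrow>\<phi>s. fst \<phi>) xs)"
  by (induction \<phi>s arbitrary: xs) (simp_all add: take_drop add.commute min_def)

lemma tensor_vals_id:
  "length xs = a \<Longrightarrow> tensor_vals (replicate a id_op) xs = xs"
  by (induction a arbitrary: xs) (auto simp: id_op_def length_Suc_conv)

lemma tensor_exp_id: "tensor_exp (replicate a id_op) = 0"
  by (induction a) (simp_all add: sum_list_replicate)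

lemma brace_Nil:
  assumes "\<And>xs. length xs \<noteq> fst f \<Longrightarrow> snd f xs = 0"
  shows "brace f [] = f"
proof -
  have "{as. length as = 1 \<and> sum_list as = fst f} = {[fst f]}"
    by (auto simp: length_Suc_conv)
  then have "snd (brace f []) xs = snd f xs" for xs
    using assms[of xs] by (auto simp: brace_def Let_def tensor_exp_id tensor_vals_id)
  then show ?thesis
    by (simp add: prod_eq_iff fst_brace fun_eq_iff)
qed

lemma tensor_exp_place:
  "tensor_exp (replicate a id_op @ g # replicate b id_op) = int a * deg_sA g"
  by (induction a)
    (simp_all add: tensor_exp_id sum_list_replicate algebra_simps)

text \<open>Only \<open>g\<close> carries a degree, and it moves past the \<open>a\<close> arguments of degree 1 to its left.\<close>

lemma brace_single:
  assumes len: "Suc (length xs) = fst f + fst g"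
  shows "snd (brace f [g]) xs =
    (\<Sum>a<fst f. ksgn (int a * deg_sA g)
       (snd f (take a xs @ snd g (take (fst g) (drop a xs)) # drop (a + fst g) xs)))"
proof -
  let ?S = "{as. length as = 2 \<and> sum_list as + 1 = fst f}"
  have "bij_betw (\<lambda>a. [a, fst f - 1 - a]) {..<fst f} ?S"
    by (rule bij_betw_byWitness[where f' = hd]) (auto simp: length_Suc_conv numeral_2_eq_2)
  then have "(\<Sum>as\<in>?S. ksgn (tensor_exp (place as [g])) (snd f (tensor_vals (place as [g]) xs)))
    = (\<Sum>a<fst f. ksgn (tensor_exp (place [a, fst f - 1 - a] [g]))
        (snd f (tensor_vals (place [a, fst f - 1 - a] [g]) xs)))"
    by (rule sum.reindex_bij_betw[symmetric])
  also have "\<dots> = (\<Sum>a<fst f. ksgn (int a * deg_sA g)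
       (snd f (take a xs @ snd g (take (fst g) (drop a xs)) # drop (a + fst g) xs)))"
  proof (rule sum.cong)
    fix a assume "a \<in> {..<fst f}"
    then have a: "a < fst f" by simp
    have "tensor_vals (place [a, fst f - 1 - a] [g]) xs
        = take a xs @ snd g (take (fst g) (drop a xs)) # drop (a + fst g) xs"
      using a len
      by (simp add: tensor_vals_append tensor_vals_id sum_list_replicate add.commute)
    then show "ksgn (tensor_exp (place [a, fst f - 1 - a] [g]))
        (snd f (tensor_vals (place [a, fst f - 1 - a] [g]) xs)) =
      ksgn (int a * deg_sA g)
       (snd f (take a xs @ snd g (take (fst g) (drop a xs)) # drop (a + fst g) xs))"
      by (simp add: tensor_exp_place)
  qed simp
  finally show ?thesis
    using len by (simp add: brace_def Let_def numeral_2_eq_2)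
qed

text \<open>The inner terms of the Hochschild differential with the sign of the insertion at position
  \<open>a\<close>, counted from 0; this is opposite to their sign in the differential.\<close>

definition inner_sum ::
    "('a \<Rightarrow> 'a \<Rightarrow> 'a) \<Rightarrow> nat \<Rightarrow> ('a list \<Rightarrow> 'a) \<Rightarrow> 'a list \<Rightarrow> 'a::ab_group_add" where
  "inner_sum b n f xs = (\<Sum>a<n. ksgn (int a) (f (take a xs @ b (xs ! a) (xs ! Suc a) # drop (a + 2) xs)))"

lemma hoch_eq_inner_sum:
  assumes "length xs = Suc n"
  shows "hoch l b r n f xs
    = l (hd xs) (f (tl xs)) - inner_sum b n f xs - ksgn (int n) (r (f (butlast xs)) (last xs))"
proof -
  have "(\<Sum>i=1..n. ksgn (int i) (f (take (i - 1) xs @ b (xs ! (i - 1)) (xs ! i) # drop (i + 1) xs)))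
      = (\<Sum>a<n. ksgn (int (Suc a)) (f (take a xs @ b (xs ! a) (xs ! Suc a) # drop (a + 2) xs)))"
    by (rule sum.reindex_bij_witness[where i = Suc and j = "\<lambda>i. i - 1"]) auto
  also have "\<dots> = - inner_sum b n f xs"
    by (simp add: inner_sum_def ksgn_Suc sum_negf)
  finally show ?thesis
    using assms by (simp add: hoch_def ksgn_def)
qed

text \<open>The two insertions of \<open>g\<close> into a product are the outer terms of the Hochschild differential.\<close>

lemma brace_binary_left:
  assumes B: "\<And>x y. snd B [x, y] = b x y" "fst B = 2" and "length xs = Suc q"
  shows "snd (brace B [(q, g)]) xs
    = b (g (butlast xs)) (last xs) - ksgn (int q) (b (hd xs) (g (tl xs)))"
proof -
  obtain x ys where x: "xs = x # ys" "length ys = q"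
    using assms(3) by (auto simp: length_Suc_conv)
  obtain zs z where z: "xs = zs @ [z]" "length zs = q"
    using assms(3) by (metis append_butlast_last_id diff_Suc_1 length_butlast length_0_conv nat.distinct(1))
  have "snd (brace B [(q, g)]) xs = snd B (g (take q xs) # drop q xs)
      + ksgn (deg_sA (q, g)) (snd B (take 1 xs @ g (take q (drop 1 xs)) # drop (Suc q) xs))"
    using assms by (subst brace_single) (simp_all add: numeral_2_eq_2)
  also have "g (take q xs) # drop q xs = [g (butlast xs), last xs]"
    using z by simp
  also have "take 1 xs @ g (take q (drop 1 xs)) # drop (Suc q) xs = [hd xs, g (tl xs)]"
    using x by simp
  finally show ?thesis
    by (auto simp: B ksgn_def deg_sA_def)
qed

text \<open>A product inserted into \<open>g\<close> has degree \<open>-1\<close> in \<open>Hom(sA \<otimes> sA, sA)\<close>, which produces the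
  alternating signs.\<close>

lemma brace_binary_right:
  assumes B: "\<And>x y. snd B [x, y] = b x y" "fst B = 2" and "length xs = Suc q"
  shows "snd (brace (q, g) [B]) xs = inner_sum b q g xs"
proof -
  have "snd B (take 2 (drop a xs)) = b (xs ! a) (xs ! Suc a)" if "a < q" for a
  proof -
    have "take 2 (drop a xs) = [xs ! a, xs ! Suc a]"
      using that assms(3) by (simp add: numeral_2_eq_2 Cons_nth_drop_Suc[symmetric])
    then show ?thesis by (simp add: B)
  qed
  then show ?thesis
    using assms(3)
    by (subst brace_single)
      (auto simp: B inner_sum_def deg_sA_def ksgn_def intro!: sum.cong)
qed

lemma brace_unary:
  assumes "fst T = 1" "\<And>x. snd T [x] = h x" "length xs = fst g"
  shows "snd (brace T [g]) xs = h (snd g xs)"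
  using assms by (subst brace_single) simp_all

lemma brace_binary_two:
  assumes "fst B = 2" "\<And>x y. snd B [x, y] = b x y" "length xs = fst g + fst h"
  shows "snd (brace B [g, h]) xs
    = ksgn (int (fst g) * deg_sA h) (b (snd g (take (fst g) xs)) (snd h (drop (fst g) xs)))"
proof -
  have "{as. length as = 3 \<and> sum_list as = (0::nat)} = {[0, 0, 0]}"
    by (auto simp: length_Suc_conv numeral_3_eq_3)
  then show ?thesis
    using assms by (simp add: brace_def Let_def numeral_2_eq_2 numeral_3_eq_3)
qed


section \<open>Brackets with the product\<close>

lemma ksgn_cong: "(even e \<longleftrightarrow> even e') \<Longrightarrow> ksgn e x = ksgn e' x"
  by (simp add: ksgn_def)

lemma sum_fun_apply: "(sum F S) x = (\<Sum>i\<in>S. F i x)" for F :: "'i \<Rightarrow> 'b \<Rightarrow> 'c::comm_monoid_add"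
  by (induction S rule: infinite_finite_induct) simp_all

lemma ksgn_apply: "ksgn e F x = ksgn e (F x)"
  by (simp add: ksgn_def)

lemma nu_pair [simp]: "nu m [x, y] = m x y"
  by (simp add: nu_def ksgn_def)

lemma tau_single [simp]: "tau P [x] = P x"
  by (simp add: tau_def)

text \<open>The two permutations, with the sign exponents reduced modulo 2; an even multiple of the
  degree of \<open>sh\<close> has been dropped from \<open>\<eta>\<close>.\<close>

lemma l_main_two:
  fixes sh g1 g2 :: "'a::ab_group_add op"
  defines "W \<equiv> \<lambda>h1 h2. snd (brace sh [h1, h2])
     + ksgn (deg_sA sh * (deg_A h1 + 1) + 1) (snd (brace h1 [brace sh [h2]]))
     + ksgn (deg_sA sh * (deg_A h1 + deg_A h2)) (snd (brace h1 [brace h2 [brace sh []]]))"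
  shows "l_main sh [g1, g2] = ksgn (deg_A g1) (W g1 g2)
     + ksgn (1 + deg_A g1 * deg_A g2 + deg_A g2) (W g2 g1)"
proof -
  let ?t = "Transposition.transpose 0 (1::nat)"
  have perms: "{\<sigma>. \<sigma> permutes {..<2}} = {id, ?t}"
  proof -
    have "{..<2} = {0, 1::nat}" by auto
    then show ?thesis by (auto simp: permutes_doubleton_iff)
  qed
  have ne: "id \<noteq> ?t"
    by (metis id_apply transpose_apply_first zero_neq_one)
  have chi_id: "chi_exp id [g1, g2] = 0"
  proof -
    have "{(i, j). i < j \<and> j < Suc (Suc 0) \<and> j < (i::nat)} = {}" by auto
    then show ?thesis by (simp only: chi_exp_def id_apply list.size sum.empty evenperm_id add_0_right add_Suc_right if_True)
  qed
  have chi_t: "chi_exp ?t [g1, g2] = 1 + deg_A g1 * deg_A g2"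
  proof -
    have "{(i, j). i < j \<and> j < Suc (Suc 0) \<and> ?t j < ?t i} = {(0, 1)}"
      by (auto simp: Transposition.transpose_def less_Suc_eq split: if_splits)
    then show ?thesis by (simp add: chi_exp_def evenperm_swap mult.commute)
  qed
  have upt: "[0..<2] = [0, 1]" by (simp add: numeral_2_eq_2)
  have Sum: "sum F {0..2} = F 0 + F 1 + F 2" for F :: "nat \<Rightarrow> 'a list \<Rightarrow> 'a"
    by (simp add: numeral_2_eq_2)
  have inner: "(\<Sum>k=0..2. let \<xi> = deg_sA sh * (\<Sum>i<k. deg_A ([h1, h2] ! i) + 1) + int k in
      ksgn \<xi> (snd (foldr (\<lambda>g acc. brace g [acc]) (take k [h1, h2]) (brace sh (drop k [h1, h2])))))
      = W h1 h2" for h1 h2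
    unfolding Sum W_def
    by (simp add: Let_def lessThan_Suc numeral_2_eq_2 ac_simps) (auto intro!: ksgn_cong)
  have summand: "(let hs = map (\<lambda>i. [g1, g2] ! \<sigma> i) [0..<2];
         \<eta> = chi_exp \<sigma> [g1, g2] + int 2 * deg_sA sh + (\<Sum>k=1..2-1. \<Sum>j<k. deg_A (hs ! j))
       in ksgn \<eta> (\<Sum>k=0..2.
            let \<xi> = deg_sA sh * (\<Sum>i<k. deg_A (hs ! i) + 1) + int k
            in ksgn \<xi> (snd (foldr (\<lambda>g acc. brace g [acc]) (take k hs) (brace sh (drop k hs))))))
      = ksgn (chi_exp \<sigma> [g1, g2] + deg_A ([g1, g2] ! \<sigma> 0)) (W ([g1, g2] ! \<sigma> 0) ([g1, g2] ! \<sigma> 1))" for \<sigma>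
    unfolding upt list.map Let_def inner[unfolded Let_def]
    by (rule ksgn_cong) simp
  have "l_main sh [g1, g2] = (\<Sum>\<sigma>\<in>{id, ?t}. ksgn (chi_exp \<sigma> [g1, g2] + deg_A ([g1, g2] ! \<sigma> 0))
      (W ([g1, g2] ! \<sigma> 0) ([g1, g2] ! \<sigma> 1)))"
    unfolding l_main_def perms[symmetric] summand[symmetric] by (simp add: Let_def numeral_2_eq_2)
  then show ?thesis
    using ne by (simp add: chi_id chi_t[unfolded One_nat_def])
qed

context nijenhuis_algebra
begin

lemma gerst_nu: "gerst (2, nu m) (n, f) = ksgn (int n + 1) (delta_Alg m n f)"
proof
  fix xs
  show "gerst (2, nu m) (n, f) xs = ksgn (int n + 1) (delta_Alg m n f) xs"
  proof (cases "length xs = Suc n")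
    case True
    have "snd (brace (2, nu m) [(n, f)]) xs
        = m (f (butlast xs)) (last xs) - ksgn (int n) (m (hd xs) (f (tl xs)))"
      by (rule brace_binary_left) (simp_all add: True)
    moreover have "snd (brace (n, f) [(2, nu m)]) xs = inner_sum m n f xs"
      by (rule brace_binary_right) (simp_all add: True)
    ultimately show ?thesis
      unfolding delta_Alg_def
      by (auto simp: gerst_def hoch_eq_inner_sum[OF True] ksgn_def deg_sA_def)
  next
    case False
    then show ?thesis
      by (auto simp: gerst_def brace_arity delta_Alg_def hoch_def ksgn_def)
  qed
qed

lemma inner_sum_mult_P:
  assumes "multilinear scale g"
  shows "inner_sum mP q g xs
    = inner_sum (\<lambda>x y. m (P x) y + m x (P y)) q g xs - inner_sum (\<lambda>x y. P (m x y)) q g xs"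
  unfolding inner_sum_def mult_P_def
  by (simp add: lin_sub[OF multilinearD[OF assms]] ksgn_diff sum_subtractf)

text \<open>The two braces with \<open>g\<close> and \<open>\<tau>\<close> both inside \<open>\<nu>\<close> are the outer terms of \<open>\<partial>\<close>. The two that
  insert \<open>\<nu>{\<tau>}\<close> or \<open>\<tau>{\<nu>}\<close> into \<open>g\<close> combine to an insertion of the deformed product, which gives
  the inner terms of \<open>\<partial>\<close>. The two with \<open>\<tau>\<close> outermost give \<open>- P \<circ> \<delta>_Alg\<close>.\<close>

lemma l_main_nu_tau:
  assumes "g \<in> Mlin scale q"
  shows "l_main (2, nu m) [(1, tau P), (q, g)] = ksgn (int q) (delta_NjO m P q g)"
proof
  fix xs :: "'a list"
  let ?\<nu> = "(2, nu m)" and ?\<tau> = "(1, tau P)" and ?g = "(q, g)"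
  have nu0: "brace ?\<nu> [] = ?\<nu>"
    by (rule brace_Nil) (simp add: nu_def)
  have "snd (brace ?\<nu> [?\<tau>]) [x, y] = m (P x) y + m x (P y)" for x y
    using brace_binary_left[of ?\<nu> m "[x, y]" 1 "tau P"] by simp
  moreover have "snd (brace ?\<tau> [?\<nu>]) [x, y] = P (m x y)" for x y
    using brace_unary[of ?\<tau> P "[x, y]" ?\<nu>] by simp
  ultimately have right: "snd (brace ?g [brace ?\<nu> [?\<tau>]]) xs = inner_sum (\<lambda>x y. m (P x) y + m x (P y)) q g xs"
    "snd (brace ?g [brace ?\<tau> [?\<nu>]]) xs = inner_sum (\<lambda>x y. P (m x y)) q g xs"
    "snd (brace ?g [?\<nu>]) xs = inner_sum m q g xs" if "length xs = Suc q"
    using that by (auto intro!: brace_binary_right simp: fst_brace)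
  show "l_main (2, nu m) [(1, tau P), (q, g)] xs = ksgn (int q) (delta_NjO m P q g) xs"
  proof (cases "length xs = Suc q")
    case True
    then obtain x ys where x: "xs = x # ys" "length ys = q"
      by (auto simp: length_Suc_conv)
    from True obtain zs z where z: "xs = zs @ [z]" "length zs = q"
      by (metis append_butlast_last_id diff_Suc_1 length_butlast length_0_conv nat.distinct(1))
    have left: "snd (brace ?\<nu> [?g]) xs = m (g (butlast xs)) (last xs) - ksgn (int q) (m (hd xs) (g (tl xs)))"
      by (rule brace_binary_left) (simp_all add: True)
    have outer: "snd (brace ?\<nu> [?\<tau>, ?g]) xs = - ksgn (int q) (m (P (hd xs)) (g (tl xs)))"
      using brace_binary_two[of ?\<nu> m xs ?\<tau> ?g] by (simp_all add: x ksgn_def deg_sA_def)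
    have outer': "snd (brace ?\<nu> [?g, ?\<tau>]) xs = m (g (butlast xs)) (P (last xs))"
      using brace_binary_two[of ?\<nu> m xs ?g ?\<tau>] by (simp add: z deg_sA_def)
    have unary: "snd (brace ?\<tau> [brace ?\<nu> [?g]]) xs = P (snd (brace ?\<nu> [?g]) xs)"
      "snd (brace ?\<tau> [brace ?g [?\<nu>]]) xs = P (snd (brace ?g [?\<nu>]) xs)"
      using True by (auto intro!: brace_unary simp: fst_brace)
    show ?thesis
      unfolding l_main_two nu0 delta_NjO_def delta_Alg_def partial_P_def
      using inner_sum_mult_P[OF multilinear_of_Mlin[OF assms], of q xs]
      by (cases "even q") (simp_all add: hoch_eq_inner_sum[OF True] right[OF True] left outer outer' unary P_dist
          deg_A_def deg_sA_def algebra_simps del: One_nat_def)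
  next
    case False
    then show ?thesis
      unfolding l_main_two nu0
      by (simp add: brace_arity fst_brace ksgn_def delta_NjO_def delta_Alg_def partial_P_def hoch_def P_dist)
  qed
qed

end

section \<open>Inserting copies of the Nijenhuis operator\<close>

text \<open>The sum of all \<open>f \<circ> P\<^sub>S\<close> with \<open>S\<close> of size \<open>j\<close>, in the indexing of the brace operations: the
  gaps between the inserted copies of \<open>P\<close> encode the subset.\<close>

definition insertions :: "('a \<Rightarrow> 'a) \<Rightarrow> ('a list \<Rightarrow> 'a::ab_group_add) \<Rightarrow> nat \<Rightarrow> 'a list \<Rightarrow> 'a" where
  "insertions P f j xs = (\<Sum>as\<in>{as. length as = Suc j \<and> sum_list as + j = length xs}.
     f (tensor_vals (place as (replicate j (1, tau P))) xs))"

lemma finite_positions: "finite {as :: nat list. length as = k \<and> sum_list as + c = n}"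
proof (rule finite_subset)
  show "{as :: nat list. length as = k \<and> sum_list as + c = n} \<subseteq> {as. set as \<subseteq> {..n} \<and> length as = k}"
    using member_le_sum_list by fastforce
qed (rule finite_lists_length_eq, simp)

lemma insertions_0: "insertions P f 0 xs = f xs"
proof -
  have "{as. length as = Suc 0 \<and> sum_list as = length xs} = {[length xs]}"
    by (auto simp: length_Suc_conv)
  then show ?thesis by (simp add: insertions_def tensor_vals_id)
qed

lemma insertions_too_many: "length xs < j \<Longrightarrow> insertions P f j xs = 0"
  by (simp add: insertions_def)

text \<open>Either the first argument is fed to the first copy of \<open>P\<close> (the leading gap is 0), or the
  leading gap is positive and shrinks by one.\<close>

lemma insertions_Cons:
  "insertions P f (Suc j) (x # xs)
     = insertions P (\<lambda>ys. f (P x # ys)) j xs + insertions P (\<lambda>ys. f (x # ys)) (Suc j) xs"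
proof -
  let ?A = "{as. length as = Suc j \<and> sum_list as + j = length xs}"
  let ?B = "{as. length as = Suc (Suc j) \<and> sum_list as + Suc j = length xs}"
  let ?inc = "\<lambda>as. Suc (hd as) # tl as"
  let ?g = "\<lambda>as. f (tensor_vals (place as (replicate (Suc j) (1, tau P))) (x # xs))"
  have split: "{as. length as = Suc (Suc j) \<and> sum_list as + Suc j = length (x # xs)} = Cons 0 ` ?A \<union> ?inc ` ?B"
    (is "?L = ?R")
  proof
    show "?L \<subseteq> ?R"
    proof
      fix as assume as: "as \<in> ?L"
      then obtain a bs where "as = a # bs" by (cases as) auto
      with as show "as \<in> ?R"
        by (cases a) (auto intro!: image_eqI[where x = "(a - 1) # bs"])
    qed
    show "?R \<subseteq> ?L" by (auto simp: length_Suc_conv)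
  qed
  have "insertions P f (Suc j) (x # xs) = sum ?g (Cons 0 ` ?A \<union> ?inc ` ?B)"
    unfolding insertions_def split ..
  also have "\<dots> = sum ?g (Cons 0 ` ?A) + sum ?g (?inc ` ?B)"
  proof (rule sum.union_disjoint)
    show "finite (Cons 0 ` ?A)" "finite (?inc ` ?B)"
      by (intro finite_imageI finite_positions)+
  qed auto
  also have "sum ?g (Cons 0 ` ?A) = insertions P (\<lambda>ys. f (P x # ys)) j xs"
    by (subst sum.reindex) (simp_all add: insertions_def)
  also have "sum ?g (?inc ` ?B) = insertions P (\<lambda>ys. f (x # ys)) (Suc j) xs"
  proof (subst sum.reindex)
    show "inj_on ?inc ?B"
    proof (rule inj_onI)
      fix as bs assume "as \<in> ?B" "bs \<in> ?B" "?inc as = ?inc bs"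
      then show "as = bs" by (cases as; cases bs) simp_all
    qed
    have "?g (?inc as) = f (x # tensor_vals (place as (replicate (Suc j) (1, tau P))) xs)" if "as \<in> ?B" for as
      using that by (cases as) (simp_all add: id_op_def)
    then show "sum (?g \<circ> ?inc) ?B = insertions P (\<lambda>ys. f (x # ys)) (Suc j) xs"
      unfolding insertions_def comp_def by (rule sum.cong[OF refl])
  qed
  finally show ?thesis .
qed

lemma tensor_exp_degree_0: "(\<And>\<phi>. \<phi> \<in> set \<phi>s \<Longrightarrow> deg_sA \<phi> = 0) \<Longrightarrow> tensor_exp \<phi>s = 0"
proof (induction \<phi>s)
  case (Cons \<phi> \<phi>s)
  then have "map deg_sA \<phi>s = map (\<lambda>_. 0) \<phi>s" by simp
  then have "(\<Sum>\<psi>\<leftarrow>\<phi>s. deg_sA \<psi>) = 0" by (simp only: sum_list_0)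
  with Cons show ?case by simp
qed simp

lemma set_place: "set (place as gs) \<subseteq> insert id_op (set gs)"
  by (induction as gs rule: place.induct) auto

lemma brace_tau_eq_insertions:
  "brace (n, f) (replicate j (1, tau P)) = (n, \<lambda>xs. if length xs = n then insertions P f j xs else 0)"
proof -
  have exp: "tensor_exp (place as (replicate j (1, tau P))) = 0" for as
    by (rule tensor_exp_degree_0) (use set_place[of as "replicate j (1, tau P)"] in
        \<open>auto simp: deg_sA_def id_op_def\<close>)
  show ?thesis
    by (simp add: brace_def Let_def exp[unfolded One_nat_def] sum_list_replicate insertions_def
        cong: if_cong)
qed

context nijenhuis_algebra
begin

text \<open>Both sides satisfy the two-term recursion of \<open>\<Phi>\<close>: the first argument is either fed to \<open>P\<close> or
  paid for by one more \<open>- P\<close> outside.\<close>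

lemma sum_insertions_eq_list_Phi:
  "length xs = n \<Longrightarrow> (\<Sum>k=0..n. ksgn (int k) ((P ^^ k) (insertions P f (n - k) xs))) = list_Phi P f xs"
proof (induction xs arbitrary: n f)
  case Nil
  then show ?case by (simp add: insertions_0)
next
  case (Cons x xs)
  interpret P: additive P by standard (rule P_dist)
  have P_add: "(P ^^ k) (u + v) = (P ^^ k) u + (P ^^ k) v" for k u v
    by (induction k) (simp_all add: P_dist)
  from Cons.prems obtain l where n: "n = Suc l" and l: "length xs = l" by auto
  let ?fP = "\<lambda>ys. f (P x # ys)" and ?f = "\<lambda>ys. f (x # ys)"
  let ?t = "\<lambda>f j k. ksgn (int k) ((P ^^ k) (insertions P f j xs))"
  have "(\<Sum>k=0..n. ksgn (int k) ((P ^^ k) (insertions P f (n - k) (x # xs))))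
      = (\<Sum>k=0..l. ?t ?fP (l - k) k + ?t ?f (n - k) k) + ?t ?f 0 n"
  proof -
    have "ksgn (int k) ((P ^^ k) (insertions P f (n - k) (x # xs))) = ?t ?fP (l - k) k + ?t ?f (n - k) k"
      if "k \<le> l" for k
      using that by (simp add: n Suc_diff_le insertions_Cons P_add ksgn_add)
    then show ?thesis by (simp add: n insertions_0)
  qed
  also have "\<dots> = (\<Sum>k=0..l. ?t ?fP (l - k) k) + (\<Sum>k=0..n. ?t ?f (n - k) k)"
    by (simp add: n sum.distrib add.assoc)
  also have "(\<Sum>k=0..n. ?t ?f (n - k) k) = ?t ?f n 0 + (\<Sum>k=0..l. ?t ?f (n - Suc k) (Suc k))"
    unfolding n by (subst sum.atLeast0_atMost_Suc_shift) (simp add: comp_def)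
  also have "?t ?f n 0 = 0"
    by (simp add: insertions_too_many n l)
  also have "(\<Sum>k=0..l. ?t ?f (n - Suc k) (Suc k)) = - P (\<Sum>k=0..l. ?t ?f (l - k) k)"
  proof -
    have "?t ?f (n - Suc k) (Suc k) = - P (?t ?f (l - k) k)" for k
      by (simp add: n ksgn_def P.minus)
    then show ?thesis by (simp only: P.sum sum_negf)
  qed
  finally show ?case
    by (simp add: Cons.IH[OF l])
qed

lemma iterated_brace_tau:
  assumes "fst h = n" "\<And>xs. length xs \<noteq> n \<Longrightarrow> snd h xs = 0"
  shows "foldr (\<lambda>g acc. brace g [acc]) (replicate k (1, tau P)) h = (n, \<lambda>xs. (P ^^ k) (snd h xs))"
proof (induction k)
  case 0
  then show ?case using assms(1) by (simp add: prod_eq_iff)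
next
  case (Suc k)
  let ?h = "(n, \<lambda>xs. (P ^^ k) (snd h xs))"
  have P0: "(P ^^ k) 0 = 0" for k
    by (induction k) (simp_all add: P_dist)
  have "snd (brace (1, tau P) [?h]) xs = (P ^^ Suc k) (snd h xs)" for xs
  proof (cases "length xs = n")
    case True
    then show ?thesis using brace_unary[of "(1, tau P)" P xs ?h] by simp
  next
    case False
    then show ?thesis using P0[of "Suc k"] by (simp add: brace_arity assms(2) del: funpow.simps)
  qed
  then show ?case
    unfolding replicate_Suc foldr_Cons comp_apply Suc by (simp add: prod_eq_iff fst_brace fun_eq_iff)
qed

text \<open>As \<open>s\<tau>\<close> has degree 0, the braces carry no sign and \<open>\<xi>\<close> reduces to \<open>k\<close>. In \<open>\<eta>\<close> the exponent of
  \<open>\<chi>\<close> is even for every permutation and \<open>n (1 - n)\<close> is even, which leaves \<open>n(n-1)/2\<close>. All \<open>n!\<close>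
  permutations contribute equally.\<close>

lemma l_main_tau:
  assumes f: "f \<in> Mlin scale n"
  shows "l_main (n, f) (replicate n (1, tau P))
    = (\<lambda>xs. scale (fact n) (ksgn (int (n * (n - 1) div 2)) (Phi P n f xs)))"
proof
  fix xs :: "'a list"
  let ?\<tau> = "(1, tau P)" and ?gs = "replicate n (1, tau P)"
  define inner where "inner hs = (\<Sum>k=0..n. let \<xi> = deg_sA (n, f) * (\<Sum>i<k. deg_A (hs ! i) + 1) + int k
    in ksgn \<xi> (snd (foldr (\<lambda>g acc. brace g [acc]) (take k hs) (brace (n, f) (drop k hs)))))" for hs
  have inner: "inner ?gs xs = Phi P n f xs"
  proof -
    have iter: "snd (foldr (\<lambda>g acc. brace g [acc]) (take k ?gs) (brace (n, f) (drop k ?gs))) ys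
        = (P ^^ k) (if length ys = n then insertions P f (n - k) ys else 0)" if "k \<le> n" for k ys
      using that
      by (simp add: min_def brace_tau_eq_insertions iterated_brace_tau del: One_nat_def foldr_replicate)
    have degs: "(\<Sum>i<k. deg_A (?gs ! i) + 1) = 0" if "k \<le> n" for k
      using that by (simp add: deg_A_def)
    have "(P ^^ k) 0 = 0" for k
      by (induction k) (simp_all add: P_dist)
    then have "(let \<xi> = deg_sA (n, f) * (\<Sum>i<k. deg_A (?gs ! i) + 1) + int k
        in ksgn \<xi> (snd (foldr (\<lambda>g acc. brace g [acc]) (take k ?gs) (brace (n, f) (drop k ?gs))))) xs
      = (if length xs = n then ksgn (int k) ((P ^^ k) (insertions P f (n - k) xs)) else 0)"
      if "k \<le> n" for k
      unfolding Let_def ksgn_apply degs[OF that] iter[OF that] by simp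
    then have "inner ?gs xs = (\<Sum>k=0..n. if length xs = n
        then ksgn (int k) ((P ^^ k) (insertions P f (n - k) xs)) else 0)"
      unfolding inner_def sum_fun_apply by (intro sum.cong) auto
    also have "\<dots> = list_Phi P f xs"
      using sum_insertions_eq_list_Phi[of xs n f] list_Phi_arity[of n f xs] Mlin_arity[OF f]
      by (cases "length xs = n") simp_all
    finally show ?thesis by (simp add: Phi_eq[OF f])
  qed
  have summand: "(let hs = map (\<lambda>i. ?gs ! \<sigma> i) [0..<n];
         \<eta> = chi_exp \<sigma> ?gs + int n * deg_sA (n, f) + (\<Sum>k=1..n-1. \<Sum>j<k. deg_A (hs ! j))
       in ksgn \<eta> (inner hs)) = ksgn (int (n * (n - 1) div 2)) (inner ?gs)"
    if \<sigma>: "\<sigma> permutes {..<n}" for \<sigma>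
  proof -
    have "\<sigma> i < n" if "i < n" for i
      using permutes_in_image[OF \<sigma>, of i] that by simp
    then have hs: "map (\<lambda>i. ?gs ! \<sigma> i) [0..<n] = ?gs"
      by (intro nth_equalityI) simp_all
    have "(\<Sum>(i, j) | i < j \<and> j < length ?gs \<and> \<sigma> j < \<sigma> i. deg_A (?gs ! \<sigma> i) * deg_A (?gs ! \<sigma> j))
        = (\<Sum>(i, j)\<in>inversions n \<sigma>. 1)"
      using \<open>\<And>i. i < n \<Longrightarrow> \<sigma> i < n\<close>
      by (intro sum.cong) (auto simp: inversions_def deg_A_def)
    then have "chi_exp \<sigma> ?gs = (if evenperm \<sigma> then 0 else 1) + int (card (inversions n \<sigma>))"
      by (simp add: chi_exp_def case_prod_unfold)
    then have "even (chi_exp \<sigma> ?gs)"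
      using evenperm_iff_even_inversions[OF \<sigma>] by simp
    moreover have "even (int n * deg_sA (n, f))"
      by (simp add: deg_sA_def)
    moreover have "(\<Sum>k=1..n-1. \<Sum>j<k. deg_A (?gs ! j)) = - int (n * (n - 1) div 2)"
    proof -
      have "(\<Sum>k=1..n-1. \<Sum>j<k. deg_A (?gs ! j)) = (\<Sum>k=1..n-1. - int k)"
        by (intro sum.cong) (auto simp: deg_A_def)
      also have "\<dots> = - int (\<Sum>{1..n-1})" by (simp add: sum_negf)
      also have "\<Sum>{1..n-1} = n * (n - 1) div 2"
        using gauss_sum_from_Suc_0[of "n - 1", where 'a = nat] by (cases n) (simp_all add: mult.commute)
      finally show ?thesis .
    qed
    ultimately show ?thesis
      unfolding hs Let_def by (intro ksgn_cong) simp
  qed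
  have "l_main (n, f) ?gs = (\<Sum>\<sigma> | \<sigma> permutes {..<n}. let hs = map (\<lambda>i. ?gs ! \<sigma> i) [0..<n];
         \<eta> = chi_exp \<sigma> ?gs + int n * deg_sA (n, f) + (\<Sum>k=1..n-1. \<Sum>j<k. deg_A (hs ! j))
       in ksgn \<eta> (inner hs))"
    by (simp only: l_main_def length_replicate inner_def Let_def)
  also have "\<dots> = (\<Sum>\<sigma> | \<sigma> permutes {..<n}. ksgn (int (n * (n - 1) div 2)) (inner ?gs))"
    by (rule sum.cong[OF refl], rule summand) simp
  finally have "l_main (n, f) ?gs = (\<Sum>\<sigma> | \<sigma> permutes {..<n}. ksgn (int (n * (n - 1) div 2)) (inner ?gs))" .
  then have "l_main (n, f) ?gs xs = (\<Sum>\<sigma> | \<sigma> permutes {..<n}. ksgn (int (n * (n - 1) div 2)) (inner ?gs xs))"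
    by (simp add: sum_fun_apply ksgn_def)
  also have "\<dots> = scale (of_nat (card {\<sigma>. \<sigma> permutes {..<n}})) (ksgn (int (n * (n - 1) div 2)) (inner ?gs xs))"
    by (rule sum_constant_scale)
  also have "card {\<sigma>. \<sigma> permutes {..<n}} = fact n"
    by (simp add: card_permutations)
  finally show "l_main (n, f) ?gs xs = scale (fact n) (ksgn (int (n * (n - 1) div 2)) (Phi P n f xs))"
    by (simp only: inner of_nat_fact)
qed

end


section \<open>Expanding the twisted differential\<close>

lemma product_lists_replicate:
  "(\<Sum>cs\<leftarrow>product_lists (replicate (Suc i) [a, b] @ yss). F cs)
     = (\<Sum>cs\<leftarrow>product_lists (replicate i [a, b] @ yss). F (a # cs))
     + (\<Sum>cs\<leftarrow>product_lists (replicate i [a, b] @ yss). F (b # cs))"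
  for F :: "'b list \<Rightarrow> 'c::comm_monoid_add"
  by (simp add: comp_def)

text \<open>The assumption excludes the tensor of two elements of \<open>C_Alg\<close>, which the Gerstenhaber
  bracket handles.\<close>

lemma l_comp_one_Alg:
  assumes "\<not> (p = 0 \<and> list_all is_Alg ys \<and> length ys = 1)"
  shows "l_comp (replicate p (NjO t) @ Alg h # ys) =
    (if list_all is_NjO ys \<and> p + length ys = fst h \<and> 1 \<le> fst h
     then (0, ksgn (deg_sA h * (int p * deg_A t) + int p) (l_main h (replicate p t @ map op_of ys)))
     else 0)"
proof -
  have split: "dropWhile is_NjO (replicate p (NjO t) @ Alg h # ys) = Alg h # ys"
    "takeWhile is_NjO (replicate p (NjO t) @ Alg h # ys) = replicate p (NjO t)"
    by (induction p) simp_all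
  have not2: "\<not> (length (replicate p (NjO t) @ Alg h # ys) = 2 \<and>
      list_all is_Alg (replicate p (NjO t) @ Alg h # ys))"
    using assms by (cases p) auto
  show ?thesis
    unfolding l_comp_def if_not_P[OF not2] split by (simp add: Let_def sum_list_replicate)
qed

lemma l_comp_no_Alg: "list_all is_NjO cs \<Longrightarrow> cs \<noteq> [] \<Longrightarrow> l_comp cs = 0"
proof -
  assume cs: "list_all is_NjO cs" "cs \<noteq> []"
  then have drop: "dropWhile is_NjO cs = []"
    by (simp add: list_all_iff)
  have "\<not> list_all is_Alg cs"
    using cs by (cases cs) (auto simp: comp.distinct_disc)
  then show ?thesis
    unfolding l_comp_def drop by simp
qed

text \<open>Expand the tensor power from the left, tracking the number \<open>p\<close> of leading copies of \<open>\<tau>\<close> until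
  the first \<open>\<nu>\<close> appears. As \<open>\<nu>\<close> has arity 2, it must then be accompanied by exactly two elements of
  \<open>C_NjO\<close>, unless the tensor is \<open>\<nu> \<otimes> f\<close>. If \<open>\<nu>\<close> never appears, only copies of \<open>\<tau>\<close> followed by \<open>f\<close> contribute.\<close>

lemma l_comp_expansion:
  fixes \<tau> \<nu> f g :: "'a::ab_group_add op"
  assumes \<nu>: "fst \<nu> = 2" "deg_A \<tau> = -1"
  defines "K \<equiv> \<lambda>i. if i = fst f \<and> 1 \<le> i
    then (0, ksgn (- (deg_sA f * int i) + int i) (l_main f (replicate i \<tau>))) else 0"
  shows "(\<Sum>cs\<leftarrow>product_lists (replicate i [Alg \<nu>, NjO \<tau>] @ [[Alg f, NjO g]]). l_comp cs)
    = (if i = 1 then (gerst \<nu> f, 0) else 0)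
    + (if i = 2 then (0, l_main \<nu> [\<tau>, g] + l_main \<nu> [\<tau>, g]) else 0) + K i"
proof -
  let ?a = "Alg \<nu>" and ?b = "NjO \<tau>" and ?c = "Alg f" and ?d = "NjO g"
  define S where "S i F = (\<Sum>cs\<leftarrow>product_lists (replicate i [?a, ?b] @ [[?c, ?d]]). F cs)"
    for i and F :: "'a comp list \<Rightarrow> ('a list \<Rightarrow> 'a) \<times> ('a list \<Rightarrow> 'a)"
  have S_0: "S 0 F = F [?c] + F [?d]" for F
    by (simp add: S_def)
  have S_Suc: "S (Suc i) F = S i (\<lambda>cs. F (?a # cs)) + S i (\<lambda>cs. F (?b # cs))" for i F
    unfolding S_def by (rule product_lists_replicate)
  \<comment> \<open>\<open>H\<close> collects the tensors whose first \<open>\<nu>\<close> comes after \<open>p\<close> copies of \<open>\<tau>\<close>; \<open>G\<close> those starting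
    with at least \<open>p\<close> copies.\<close>
  define H where "H p i = S i (\<lambda>cs. l_comp (replicate p ?b @ ?a # cs))" for p i
  define G where "G p i = S i (\<lambda>cs. l_comp (replicate p ?b @ cs))" for p i
  have G_Suc: "G p (Suc i) = H p i + G (Suc p) i" for p i
    by (simp add: G_def H_def S_Suc replicate_app_Cons_same)
  have G_0: "G p 0 = K p" for p
  proof -
    have "l_comp (replicate p ?b @ [?d]) = 0"
      by (rule l_comp_no_Alg) (simp_all add: list_all_iff)
    moreover have "l_comp (replicate p ?b @ [?c]) = K p"
      using \<nu> by (subst l_comp_one_Alg) (auto simp: K_def)
    ultimately show ?thesis by (simp add: G_def S_0)
  qed
  have H_large: "H p i = 0" if "p + i \<ge> 2" for p i
  proof -
    have "l_comp (replicate p ?b @ ?a # cs) = 0" if "length cs = Suc i" for cs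
      using that \<open>p + i \<ge> 2\<close> \<nu> by (subst l_comp_one_Alg) auto
    then have "map (\<lambda>cs. l_comp (replicate p ?b @ ?a # cs)) (product_lists (replicate i [?a, ?b] @ [[?c, ?d]]))
        = map (\<lambda>_. 0) (product_lists (replicate i [?a, ?b] @ [[?c, ?d]]))"
      by (intro map_cong refl) (auto dest: in_set_product_lists_length)
    then show ?thesis unfolding H_def S_def by (simp only: sum_list_0)
  qed
  have two: "l_comp (?a # ys) = (if list_all is_NjO ys \<and> length ys = 2 then (0, l_main \<nu> (map op_of ys)) else 0)"
    if "length ys \<noteq> 1 \<or> \<not> list_all is_Alg ys" for ys
    using l_comp_one_Alg[of 0 ys \<tau> \<nu>] that \<nu> by auto
  have "l_comp [?a, ?c] = (gerst \<nu> f, 0)"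
    by (simp add: l_comp_def)
  then have H00: "H 0 0 = (gerst \<nu> f, 0)"
    by (simp add: H_def S_0 two)
  have H01: "H 0 (Suc 0) = (0, l_main \<nu> [\<tau>, g])"
    by (simp add: H_def S_0 S_Suc two)
  have "l_comp [?b, ?a, ?c] = 0" "l_comp [?b, ?a, ?d] = (0, l_main \<nu> [\<tau>, g])"
    using l_comp_one_Alg[of 1 "[?c]" \<tau> \<nu>] l_comp_one_Alg[of 1 "[?d]" \<tau> \<nu>] \<nu>
    by (simp_all add: deg_sA_def)
  then have H10: "H (Suc 0) 0 = (0, l_main \<nu> [\<tau>, g])"
    by (simp add: H_def S_0)
  have G_large: "G p i = K (p + i)" if "p \<ge> 2" for p i
    using that by (induction i arbitrary: p) (simp_all add: G_0 G_Suc H_large)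
  have "G 0 i = (if i = 1 then (gerst \<nu> f, 0) else 0)
    + (if i = 2 then (0, l_main \<nu> [\<tau>, g] + l_main \<nu> [\<tau>, g]) else 0) + K i"
  proof -
    consider "i = 0" | "i = 1" | "i = 2" | j where "i = Suc (Suc (Suc j))"
      by (metis One_nat_def Suc_1 not0_implies_Suc)
    then show ?thesis
    proof cases
      case (4 j)
      then show ?thesis by (simp add: G_Suc H_large G_large)
    qed (simp_all add: G_0 G_Suc H00 H01 H10 numeral_2_eq_2)
  qed
  then show ?thesis by (simp add: G_def S_def)
qed

lemma ksgn_Pair: "ksgn e (x, y) = (ksgn e x, ksgn e y)"
  by (simp add: ksgn_def)

lemma triangle_Suc: "(a + 1) * (a + 2) div 2 = a * (a + 1) div 2 + (a + 1)" for a :: int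
proof -
  have "(a + 1) * (a + 2) = a * (a + 1) + 2 * (a + 1)" by (simp add: algebra_simps)
  then show ?thesis by simp
qed

context nijenhuis_algebra
begin

lemma twisted_l1_eq:
  fixes d :: int
  defines "n \<equiv> nat (1 - d)" and "q \<equiv> nat (- d)"
  assumes f: "f \<in> Mlin scale n" and g: "g \<in> Mlin scale q"
  shows "twisted_l1 scale (mc_elt m P) (d, (f, g)) =
    (ksgn (int n) (delta_Alg m n f), (if 1 \<le> n then Phi P n f else 0) - ksgn (int q) (delta_NjO m P q g))"
proof -
  interpret pair: module "pair_scale scale" by (rule module_pair_scale)
  let ?L = "l_main (2, nu m) [(1, tau P), (q, g)]"
  define K where "K i = (if i = n \<and> 1 \<le> i
    then (0, ksgn (- (deg_sA (n, f) * int i) + int i) (l_main (n, f) (replicate i (1, tau P)))) else (0 :: ('a list \<Rightarrow> 'a) \<times> ('a list \<Rightarrow> 'a)))" for i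
  define T where "T i = pair_scale scale (inverse (fact i))
      (ksgn (int (i * (i + 1) div 2)) (l_NjA (replicate i (mc_elt m P) @ [(d, (f, g))])))" for i
  have l_NjA: "l_NjA (replicate i (mc_elt m P) @ [(d, (f, g))])
      = (if i = 1 then (gerst (2, nu m) (n, f), 0) else 0) + (if i = 2 then (0, ?L + ?L) else 0) + K i" for i
  proof -
    have comps: "comps (mc_elt m P) = [Alg (2, nu m), NjO (1, tau P)]"
      "comps (d, (f, g)) = [Alg (n, f), NjO (q, g)]"
      by (simp_all add: comps_def mc_elt_def n_def q_def)
    show ?thesis
      unfolding l_NjA_def K_def map_append map_replicate list.map comps
      by (rule l_comp_expansion[where \<nu> = "(2, nu m)" and \<tau> = "(1, tau P)" and f = "(n, f)"
            and g = "(q, g)", unfolded fst_conv]) (simp_all add: deg_A_def)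
  qed
  have K: "pair_scale scale (inverse (fact i)) (ksgn (int (i * (i + 1) div 2)) (K i))
      = (if i = n then (0, if 1 \<le> n then Phi P n f else 0) else 0)" for i
  proof (cases "i = n \<and> 1 \<le> n")
    case True
    \<comment> \<open>The signs of the twisting sum, of moving \<open>f\<close> to the front past \<open>n\<close> copies of \<open>\<tau>\<close>, and of
      \<open>l_main_tau\<close>.\<close>
    have "even (int (n * (n + 1) div 2) + (- (deg_sA (n, f) * int n) + int n) + int (n * (n - 1) div 2))"
    proof -
      obtain k where "n = Suc k" using True by (cases n) auto
      then have "n * (n + 1) div 2 = n * (n - 1) div 2 + n" by simp
      then show ?thesis by (simp add: deg_sA_def)
    qed
    then have L: "ksgn (int (n * (n + 1) div 2)) (ksgn (- (deg_sA (n, f) * int n) + int n)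
        (l_main (n, f) (replicate n (1, tau P)))) = (\<lambda>xs. scale (fact n) (Phi P n f xs))"
      unfolding l_main_tau[OF f] fun_eq_iff ksgn_apply by (auto simp: ksgn_def)
    have "K i = (0, ksgn (- (deg_sA (n, f) * int n) + int n) (l_main (n, f) (replicate n (1, tau P))))"
      using True unfolding K_def by simp
    then have "ksgn (int (i * (i + 1) div 2)) (K i) = (0, \<lambda>xs. scale (fact n) (Phi P n f xs))"
      using True by (simp only: ksgn_Pair L ksgn_simps)
    then show ?thesis
      using True by (simp add: pair_scale_def zero_fun_def)
  next
    case False
    then show ?thesis by (auto simp: K_def zero_prod_def[symmetric])
  qed
  have T: "T i = (if i = 1 then (- gerst (2, nu m) (n, f), 0) else 0) + (if i = 2 then (0, - ?L) else 0)
      + (if i = n then (0, if 1 \<le> n then Phi P n f else 0) else 0)" for i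
  proof -
    have "pair_scale scale (inverse (fact 2)) (ksgn 3 (0, ?L + ?L)) = (0, - ?L)"
    proof -
      have "scale (inverse (fact 2)) (- (y + y)) = - y" for y
      proof -
        have "y + y = scale 2 y"
          using scale_left_distrib[of 1 1 y] by simp
        then show ?thesis by (simp add: scale_minus_right)
      qed
      then show ?thesis by (simp add: pair_scale_def fun_eq_iff)
    qed
    then show ?thesis
      unfolding T_def l_NjA ksgn_add pair.scale_right_distrib K
      by auto
  qed
  have "twisted_l1 scale (mc_elt m P) (d, (f, g)) = Sum_any T"
    by (simp add: twisted_l1_def T_def[abs_def])
  also have "\<dots> = sum T {1, 2, n}"
    by (rule Sum_any.expand_superset) (auto simp: T split: if_splits)
  also have "\<dots> = (- gerst (2, nu m) (n, f), 0) + (0, - ?L) + (0, if 1 \<le> n then Phi P n f else 0)"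
    unfolding T sum.distrib by (simp add: sum.delta' sum.delta)
  also have "\<dots> = (ksgn (int n) (delta_Alg m n f), (if 1 \<le> n then Phi P n f else 0) - ksgn (int q) (delta_NjO m P q g))"
    unfolding gerst_nu l_main_nu_tau[OF g] by (simp add: ksgn_def)
  finally show ?thesis .
qed

lemma delta_Alg_ksgn: "f \<in> Mlin scale n \<Longrightarrow> delta_Alg m n (ksgn e f) = ksgn e (delta_Alg m n f)"
  using delta_Alg_add[of f n "- f"] delta_Alg_add[of 0 n 0]
  by (simp add: ksgn_def Mlin_minus Mlin_0 eq_neg_iff_add_eq_0 add.commute)

lemma Phi_ksgn: "f \<in> Mlin scale n \<Longrightarrow> Phi P n (ksgn e f) = ksgn e (Phi P n f)"
  using Phi_add[of f n "- f"] Phi_add[of 0 n 0]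
  by (simp add: ksgn_def Mlin_minus Mlin_0 eq_neg_iff_add_eq_0 add.commute)

lemma delta_NjO_ksgn: "f \<in> Mlin scale n \<Longrightarrow> delta_NjO m P n (ksgn e f) = ksgn e (delta_NjO m P n f)"
  by (simp add: ksgn_def delta_NjO_uminus)

lemma delta_0 [simp]: "delta_Alg m n 0 = 0" "delta_NjO m P n 0 = 0" "Phi P n 0 = 0"
  using delta_Alg_add[of 0 n 0] delta_NjO_add[of 0 n 0] Phi_add[of 0 n 0] by (simp_all add: Mlin_0)

text \<open>The exponents \<open>n(n+1)/2\<close> and \<open>n(n-1)/2\<close> for \<open>n = 1 - d\<close>.\<close>

definition sign_change :: "int \<Rightarrow> ('a list \<Rightarrow> 'a) \<times> ('a list \<Rightarrow> 'a) \<Rightarrow> ('a list \<Rightarrow> 'a) \<times> ('a list \<Rightarrow> 'a)" where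
  "sign_change d x = (ksgn ((1 - d) * (2 - d) div 2) (fst x), ksgn (- d * (1 - d) div 2) (snd x))"

text \<open>From \<open>n\<close> to \<open>n + 1\<close> the exponents grow by \<open>n + 1\<close> and \<open>n\<close>, which turns \<open>- \<delta>_Alg\<close> into
  \<open>(-1)\<^sup>n \<delta>_Alg\<close> and \<open>\<delta>_NjO\<close> into \<open>(-1)\<^sup>n \<delta>_NjO\<close>. The component \<open>\<Phi>\<^sup>n\<close> goes from the first summand in degree \<open>d\<close> to the
  second in degree \<open>d - 1\<close>, where the exponent is the same.\<close>

lemma twisted_l1_sign_change:
  assumes x: "x \<in> L_NjA scale d"
  shows "twisted_l1 scale (mc_elt m P) (d, x)
    = sign_change (d - 1) (dif (sC_NjA_pos scale m P) d (sign_change d x))"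
proof -
  obtain f g where fg: "x = (f, g)" by (cases x)
  have f: "f \<in> Mlin scale (nat (1 - d))" and g: "g \<in> Mlin scale (nat (- d))"
    using x by (auto simp: fg L_NjA_def Mlin_0 split: if_splits)
  show ?thesis
  proof (cases "d \<le> 0")
    case True
    let ?n = "nat (1 - d)" and ?q = "nat (- d)"
    have n: "int ?n = 1 - d" "int ?q = - d" "?n - 1 = ?q" "?n \<noteq> 0"
      using True by auto
    have "(2 - d) * (3 - d) div 2 = (1 - d) * (2 - d) div 2 + (2 - d)"
      "(1 - d) * (2 - d) div 2 = - d * (1 - d) div 2 + (1 - d)"
      using triangle_Suc[of "1 - d"] triangle_Suc[of "- d"] by (simp_all add: algebra_simps)
    then show ?thesis
      using True f g n
      by (simp add: fg twisted_l1_eq[OF f g] sign_change_def sC_NjA_pos_def sC_NjA_def shift_cochain_def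
          delta_NjA_def delta_Alg_ksgn Phi_ksgn delta_NjO_ksgn)
        (auto simp: ksgn_def)
  next
    case False
    then have "f = 0" "g = 0"
      using x by (auto simp: fg L_NjA_def split: if_splits)
    then show ?thesis
      using twisted_l1_eq[OF f g]
      by (simp add: fg sign_change_def sC_NjA_pos_def sC_NjA_def shift_cochain_def delta_NjA_def zero_prod_def)
  qed
qed

lemma complex_isomorphic_twisted:
  "complex_isomorphic (pair_scale scale) (twisted_complex scale (mc_elt m P)) (sC_NjA_pos scale m P)"
proof (rule complex_isomorphic_of_involutions[where \<phi> = sign_change])
  show "chain_complex (pair_scale scale) (sC_NjA_pos scale m P)"
    using subcomplex_sC_NjA_pos by (simp add: subcomplex_def)
  show "module (pair_scale scale)" by (rule module_pair_scale)
  show "cmp (twisted_complex scale (mc_elt m P)) = cmp (sC_NjA_pos scale m P)"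
    by (simp add: twisted_complex_def cmp_sC_NjA_pos)
  show "sign_change d (sign_change d x) = x" for d x
    by (simp add: sign_change_def ksgn_def)
  show "linear_map_on (pair_scale scale) (cmp (sC_NjA_pos scale m P) d) (cmp (sC_NjA_pos scale m P) d)
      (sign_change d)" for d
    unfolding cmp_sC_NjA_pos
    by (auto simp: linear_map_on_def sign_change_def pair_scale_def ksgn_def L_NjA_def fun_eq_iff
        scale_minus_right Mlin_minus split: if_splits)
  show "dif (twisted_complex scale (mc_elt m P)) d x
      = sign_change (d - 1) (dif (sC_NjA_pos scale m P) d (sign_change d x))"
    if "x \<in> cmp (sC_NjA_pos scale m P) d" for d x
    using that by (simp add: twisted_complex_def cmp_sC_NjA_pos twisted_l1_sign_change)
qed

end


theorem proposition5p5:
  fixes scale :: "'k::field_char_0 \<Rightarrow> 'a::ab_group_add \<Rightarrow> 'a"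
    and m :: "'a \<Rightarrow> 'a \<Rightarrow> 'a" and P :: "'a \<Rightarrow> 'a"
  assumes "nijenhuis_algebra scale m P"
  shows "subcomplex (pair_scale scale) (sC_NjA_pos scale m P) (sC_NjA scale m P)
    \<and> (\<forall>d<0. cmp (sC_NjA_pos scale m P) d = cmp (sC_NjA scale m P) d)
    \<and> complex_isomorphic (pair_scale scale)
          (twisted_complex scale (mc_elt m P)) (sC_NjA_pos scale m P)"
proof -
  interpret nijenhuis_algebra scale m P by fact
  show ?thesis
    using subcomplex_sC_NjA_pos cmp_sC_NjA_pos_negative complex_isomorphic_twisted by blast
qed

end
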